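(* Let $m,\beta,\sigma$ be nonzero real constants. Let $\widetilde\phi(x,t)$ (for $x\le 0$) and $\phi(x,t)$ (for $x\ge 0$) be the sine-Gordon fields on either side of a defect located at $x=0$, with $\widetilde\Pi=-\widetilde\phi_x$ and $\Pi=-\phi_x$, satisfying at $x=0$ the boundary conditions as $t\to\pm\infty$ stated in the context. Consider the defect conditions at $x=0$ (for all $t$) $$\widetilde{\phi}_x-\phi_t=\frac{m}{\beta}\Big(\sigma\sin\tfrac{\beta(\widetilde{\phi}+\phi)}{2}+\sigma^{-1}\sin\tfrac{\beta(\widetilde{\phi}-\phi)}{2}\Big),$$ $$\widetilde{\phi}_t-\phi_x=\frac{m}{\beta}\Big(\sigma\sin\tfrac{\beta(\widetilde{\phi}+\phi)}{2}-\sigma^{-1}\sin\tfrac{\beta(\widetilde{\phi}-\phi)}{2}\Big).$$ Then these conditions define a canonical transformation between $(\phi,\Pi)$ and $(\widetilde\phi,\widetilde\Pi)$ at $x=0$ with respect to the equal-space bracket $\{\ ,\ \}_T$, in the sense given in the context. Precisely: (1) The defect conditions are equivalent to $$\Pi(0,t)=\frac{\delta S_T}{\delta\phi(0,t)},\qquad \widetilde\Pi(0,t)=-\frac{\delta S_T}{\delta\widetilde\phi(0,t)},$$ where $$S_T=\int_{-\infty}^{\infty}\mathcal L_{defect}\,dt,\qquad \mathcal L_{defect}=\tfrac12\big(\widetilde\phi\,\phi_t-\phi\,\widetilde\phi_t\big)-\mathcal B,$$ $$\mathcal B=\frac{2m}{\beta^2}\Big(\sigma\cos\tfrac{\beta(\widetilde\phi+\phi)}{2}+\sigma^{-1}\cos\tfrac{\beta(\widetilde\phi-\phi)}{2}\Big),$$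 all fields being evaluated at $x=0$. (2) The form of all conserved quantities (in space) is preserved: for every $n\in\mathbb Z$ there is a constant $E_n$, depending only on $n$, the parameters and the integers $\mathcal Q_\pm,\widetilde{\mathcal Q}_\pm$ giving the limits of the fields as $t\to\pm\infty$, such that, whenever the defect conditions hold, $\widetilde J_n=J_n+E_n$, where $J_n$ and $\widetilde J_n$ are the integrals defined in the context computed from $(\phi,\Pi)(0,\cdot)$ and $(\widetilde\phi,\widetilde\Pi)(0,\cdot)$ respectively.
   Context: **Model.** The sine-Gordon equation is $\phi_{tt}-\phi_{xx}+\frac{m^2}{\beta}\sin\beta\phi=0$, with Lagrangian density $\frac12(\phi_t^2-\phi_x^2)-\frac{m^2}{\beta^2}(1-\cos\beta\phi)$. The momentum conjugate with respect to $x$ is $\Pi=\partial\mathcal L/\partial\phi_x=-\phi_x$. **Boundary conditions.** At fixed $x$, as functions of $t$, $\phi\to 2\pi\mathcal Q_\pm/\beta$ as $t\to\pm\infty$ with $\mathcal Q_\pm\in\mathbb Z$, and $\Pi\to0$ as $|t|\to\infty$, the limits being approached in the Schwartz sense. The same holds for $\widetilde\phi,\widetilde\Pi$ with integers $\widetilde{\mathcal Q}_\pm$. **Equal-space bracket.** At a fixed location $x_0$, $\{\phi(x_0,t),\Pi(x_0,\tau)\}_T=\delta(t-\tau)$ and $\{\phi(x_0,t),\phi(x_0,\tau)\}_T=0=\{\Pi(x_0,t),\Pi(x_0,\tau)\}_T$. The same relations are imposed for $(\widetilde\phi,\widetilde\Pi)$. **Canonical transformation.** With $\phi(0,\cdot)$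 and $\widetilde\phi(0,\cdot)$ taken as the functionally independent variables, a transformation between $(\phi,\Pi)$ and $(\widetilde\phi,\widetilde\Pi)$ is called canonical for $\{\ ,\ \}_T$ if there is a generating functional $S_T$ with $\int(\Pi\,d\phi-\widetilde\Pi\,d\widetilde\phi)\,dt=dS_T$, where $d$ denotes variations of the fields that vanish as $t\to\pm\infty$. Equivalently, $\Pi=\delta S_T/\delta\phi$ and $\widetilde\Pi=-\delta S_T/\delta\widetilde\phi$. In addition, all integrals of motion (in space) of the two sides must agree up to additive constants. **Integrals $J_n$.** Let $\sigma_1,\sigma_2,\sigma_3$ be the Pauli matrices, let $k_0(\lambda)=\frac m4(\lambda+\lambda^{-1})$ and $k_1(\lambda)=\frac m4(\lambda-\lambda^{-1})$, and set $$V(t,\lambda)=\tfrac{i\beta}{4}\Pi\,\sigma_3-ik_1(\lambda)\sin\tfrac{\beta\phi}{2}\,\sigma_1-ik_0(\lambda)\cos\tfrac{\beta\phi}{2}\,\sigma_2 .$$ Let $\mathcal T(t,\tau,\lambda)$ solve $\partial_t\mathcal T=V\mathcal T$ with $\mathcal T(\tau,\tau,\lambda)=\mathbf 1$. Put $N=\frac1{\sqrt2}(\mathbf 1+i\sigma_1)$ and $\mathcal E_\pm(t,\lambda)=e^{i\frac{\pi}{2}\mathcal Q_\pm\sigma_3}Ne^{-ik_0(\lambda)t\sigma_3}$ (here $\pi$ is the number). For real $\lambda\ne0$ the time monodromy matrix is $$\mathcal T(\lambda)=\lim_{t\to\infty,\ \tau\to-\infty}\mathcal E_+^{-1}(t,\lambda)\,\mathcal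 T(t,\tau,\lambda)\,\mathcal E_-(\tau,\lambda),$$ and $\mathfrak a(\lambda)$ denotes its $(1,1)$ entry. The $J_n$, $n\in\mathbb Z$, are the coefficients of the asymptotic expansions $$\ln\mathfrak a(\lambda)=i\sum_{n\ge1}J_n\lambda^{-n}\ (\lambda\to\infty),\qquad \ln\mathfrak a(\lambda)=i\sum_{n\ge0}J_{-n}\lambda^{n}\ (\lambda\to0),$$ where $J_0=-\frac\beta2\big(\phi(t=+\infty)-\phi(t=-\infty)\big)$ fixes the branch of the logarithm. The $\widetilde J_n$ are defined identically from $(\widetilde\phi,\widetilde\Pi)$.
   Formalization: The integral of L_defect over the line diverges (L_defect tends to nonzero constants as t→±∞), so S_T is taken as the integral of L_defect minus its limiting constant on each half-line t<0, t≥0; these constants depend only on the parameters and the integers Q±, Q~±. *)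

theory Defs
  imports "HOL-Analysis.Analysis" "HOL-Library.Landau_Symbols"
begin

section \<open>Asymptotics in time and variations\<close>

definition smooth :: "(real \<Rightarrow> real) \<Rightarrow> bool" where
  "smooth f \<longleftrightarrow> (\<forall>k t. (deriv ^^ k) f differentiable (at t))"

definition schwartz_limit :: "real filter \<Rightarrow> (real \<Rightarrow> real) \<Rightarrow> real \<Rightarrow> bool" where
  "schwartz_limit F f c \<longleftrightarrow>
     (\<forall>k N. ((\<lambda>t. t ^ N * (deriv ^^ k) (\<lambda>s. f s - c) t) \<longlongrightarrow> 0) F)"

definition schwartz :: "(real \<Rightarrow> real) \<Rightarrow> bool" where
  "schwartz h \<longleftrightarrow> smooth h \<and> schwartz_limit at_bot h 0 \<and> schwartz_limit at_top h 0"

text \<open>Boundary conditions in time for a field restricted to one location \<open>x\<close>; \<open>Qm\<close> and \<open>Qp\<close>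
  are the integers for \<open>t \<rightarrow> -\<infinity>\<close> and \<open>t \<rightarrow> +\<infinity>\<close>. The condition on its momentum is \<open>schwartz\<close>.\<close>

definition field_boundary :: "real \<Rightarrow> int \<Rightarrow> int \<Rightarrow> (real \<Rightarrow> real) \<Rightarrow> bool" where
  "field_boundary \<beta> Qm Qp u \<longleftrightarrow> smooth u \<and>
     schwartz_limit at_bot u (2 * pi * of_int Qm / \<beta>) \<and>
     schwartz_limit at_top u (2 * pi * of_int Qp / \<beta>)"

definition phase_space :: "real \<Rightarrow> int \<Rightarrow> int \<Rightarrow> ((real \<Rightarrow> real) \<times> (real \<Rightarrow> real)) set" where
  "phase_space \<beta> Qm Qp = {(u, p). field_boundary \<beta> Qm Qp u \<and> schwartz p}"

text \<open>\<open>g = \<delta>F/\<delta>f\<close>. The admissible variations are Schwartz functions, so that the varied field stays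
  in the same phase space.\<close>

definition has_functional_derivative ::
    "((real \<Rightarrow> real) \<Rightarrow> real) \<Rightarrow> (real \<Rightarrow> real) \<Rightarrow> (real \<Rightarrow> real) \<Rightarrow> bool" where
  "has_functional_derivative F f g \<longleftrightarrow>
     (\<forall>h. schwartz h \<longrightarrow>
        integrable lborel (\<lambda>t. g t * h t) \<and>
        ((\<lambda>\<epsilon>. F (\<lambda>t. f t + \<epsilon> * h t)) has_real_derivative (LBINT t. g t * h t)) (at 0))"


section \<open>Sine-Gordon fields on a half-line\<close>

text \<open>\<open>X\<close> is the range of \<open>x\<close>; the derivative is one-sided at an end point of \<open>X\<close>.\<close>

definition dx :: "real set \<Rightarrow> (real \<Rightarrow> real \<Rightarrow> real) \<Rightarrow> real \<Rightarrow> real \<Rightarrow> real" where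
  "dx X f x t = vector_derivative (\<lambda>y. f y t) (at x within X)"

definition dt :: "(real \<Rightarrow> real \<Rightarrow> real) \<Rightarrow> real \<Rightarrow> real \<Rightarrow> real" where
  "dt f x t = deriv (f x) t"

definition sine_gordon_on :: "real \<Rightarrow> real \<Rightarrow> real set \<Rightarrow> (real \<Rightarrow> real \<Rightarrow> real) \<Rightarrow> bool" where
  "sine_gordon_on m \<beta> X \<phi> \<longleftrightarrow>
     (\<forall>x\<in>X. \<forall>t.
        (\<lambda>y. \<phi> y t) differentiable (at x within X) \<and>
        (\<lambda>y. dx X \<phi> y t) differentiable (at x within X) \<and>
        \<phi> x differentiable (at t) \<and>
        dt \<phi> x differentiable (at t) \<and>
        dt (dt \<phi>) x t - dx X (dx X \<phi>) x t + m\<^sup>2 / \<beta> * sin (\<beta> * \<phi> x t) = 0)"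

definition momentum :: "real set \<Rightarrow> (real \<Rightarrow> real \<Rightarrow> real) \<Rightarrow> real \<Rightarrow> real \<Rightarrow> real" where
  "momentum X \<phi> x t = - dx X \<phi> x t"


section \<open>The defect at \<open>x = 0\<close>\<close>

text \<open>\<open>u, ux\<close> are \<open>\<phi>(0,\<cdot>), \<phi>\<^sub>x(0,\<cdot>)\<close> and \<open>v, vx\<close> are the same for the field with a tilde.\<close>

definition defect_conditions ::
    "real \<Rightarrow> real \<Rightarrow> real \<Rightarrow> (real \<Rightarrow> real) \<Rightarrow> (real \<Rightarrow> real) \<Rightarrow> (real \<Rightarrow> real) \<Rightarrow> (real \<Rightarrow> real) \<Rightarrow> bool" where
  "defect_conditions m \<beta> \<sigma> u ux v vx \<longleftrightarrow>
     (\<forall>t. vx t - deriv u t =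
            m / \<beta> * (\<sigma> * sin (\<beta> * (v t + u t) / 2) + 1 / \<sigma> * sin (\<beta> * (v t - u t) / 2)) \<and>
          deriv v t - ux t =
            m / \<beta> * (\<sigma> * sin (\<beta> * (v t + u t) / 2) - 1 / \<sigma> * sin (\<beta> * (v t - u t) / 2)))"

text \<open>The conditions as a relation between the points \<open>(\<phi>, \<Pi>)\<close> and \<open>(\<phi>\<^sup>~, \<Pi>\<^sup>~)\<close> of the two
  phase spaces at \<open>x = 0\<close>, where \<open>\<phi>\<^sub>x = - \<Pi>\<close>.\<close>

definition defect_transformation ::
    "real \<Rightarrow> real \<Rightarrow> real \<Rightarrow> (real \<Rightarrow> real) \<times> (real \<Rightarrow> real) \<Rightarrow> (real \<Rightarrow> real) \<times> (real \<Rightarrow> real) \<Rightarrow> bool" where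
  "defect_transformation m \<beta> \<sigma> = (\<lambda>(u, p) (v, q).
     defect_conditions m \<beta> \<sigma> u (\<lambda>t. - p t) v (\<lambda>t. - q t))"

text \<open>Two sine-Gordon fields, \<open>\<phi>\<close> on \<open>x \<ge> 0\<close> and \<open>\<phi>t\<close> (the field with a tilde) on \<open>x \<le> 0\<close>,
  obeying the boundary conditions in time at \<open>x = 0\<close>.\<close>

definition defect_fields ::
    "real \<Rightarrow> real \<Rightarrow> int \<Rightarrow> int \<Rightarrow> int \<Rightarrow> int \<Rightarrow>
     (real \<Rightarrow> real \<Rightarrow> real) \<Rightarrow> (real \<Rightarrow> real \<Rightarrow> real) \<Rightarrow> bool" where
  "defect_fields m \<beta> Qm Qp Qtm Qtp \<phi> \<phi>t \<longleftrightarrow>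
     sine_gordon_on m \<beta> {0..} \<phi> \<and> sine_gordon_on m \<beta> {..0} \<phi>t \<and>
     (\<phi> 0, momentum {0..} \<phi> 0) \<in> phase_space \<beta> Qm Qp \<and>
     (\<phi>t 0, momentum {..0} \<phi>t 0) \<in> phase_space \<beta> Qtm Qtp"

definition defect_B :: "real \<Rightarrow> real \<Rightarrow> real \<Rightarrow> real \<Rightarrow> real \<Rightarrow> real" where
  "defect_B m \<beta> \<sigma> a b =
     2 * m / \<beta>\<^sup>2 * (\<sigma> * cos (\<beta> * (b + a) / 2) + 1 / \<sigma> * cos (\<beta> * (b - a) / 2))"

definition L_defect :: "real \<Rightarrow> real \<Rightarrow> real \<Rightarrow> (real \<Rightarrow> real) \<Rightarrow> (real \<Rightarrow> real) \<Rightarrow> real \<Rightarrow> real" where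
  "L_defect m \<beta> \<sigma> u v t =
     (v t * deriv u t - u t * deriv v t) / 2 - defect_B m \<beta> \<sigma> (u t) (v t)"

text \<open>As \<open>t \<rightarrow> \<plusminus>\<infinity>\<close>, \<open>L_defect\<close> tends to a constant \<open>\<plusminus> 2m/\<beta>\<^sup>2 (\<sigma> + 1/\<sigma>) \<noteq> 0\<close>, so it is not integrable
  over the line. The constant depends only on the phase spaces, not on the fields; it is
  subtracted on each half-line. This changes \<open>S_T\<close> by a field-independent (infinite) constant and
  leaves its variations as they are.\<close>

definition L_vacuum ::
    "real \<Rightarrow> real \<Rightarrow> real \<Rightarrow> int \<Rightarrow> int \<Rightarrow> int \<Rightarrow> int \<Rightarrow> real \<Rightarrow> real" where
  "L_vacuum m \<beta> \<sigma> Qm Qp Qtm Qtp t =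
     (if t < 0 then - defect_B m \<beta> \<sigma> (2 * pi * of_int Qm / \<beta>) (2 * pi * of_int Qtm / \<beta>)
      else - defect_B m \<beta> \<sigma> (2 * pi * of_int Qp / \<beta>) (2 * pi * of_int Qtp / \<beta>))"

definition S_T ::
    "real \<Rightarrow> real \<Rightarrow> real \<Rightarrow> int \<Rightarrow> int \<Rightarrow> int \<Rightarrow> int \<Rightarrow> (real \<Rightarrow> real) \<Rightarrow> (real \<Rightarrow> real) \<Rightarrow> real" where
  "S_T m \<beta> \<sigma> Qm Qp Qtm Qtp u v =
     (LBINT t. L_defect m \<beta> \<sigma> u v t - L_vacuum m \<beta> \<sigma> Qm Qp Qtm Qtp t)"


section \<open>Time monodromy matrix and the integrals \<open>J\<^sub>n\<close>\<close>

definition pauli1 :: "complex^2^2" where "pauli1 = vector [vector [0, 1], vector [1, 0]]"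
definition pauli2 :: "complex^2^2" where "pauli2 = vector [vector [0, - \<i>], vector [\<i>, 0]]"
definition pauli3 :: "complex^2^2" where "pauli3 = vector [vector [1, 0], vector [0, -1]]"

definition cscale :: "complex \<Rightarrow> complex^2^2 \<Rightarrow> complex^2^2" (infixr "\<odot>" 75) where
  "c \<odot> A = (\<chi> i j. c * A $ i $ j)"

text \<open>The matrix exponential of \<open>z \<sigma>\<^sub>3\<close>; the exponent is diagonal.\<close>

definition exp_pauli3 :: "complex \<Rightarrow> complex^2^2" where
  "exp_pauli3 z = vector [vector [exp z, 0], vector [0, exp (- z)]]"

definition k0 :: "real \<Rightarrow> real \<Rightarrow> real" where "k0 m l = m / 4 * (l + 1 / l)"
definition k1 :: "real \<Rightarrow> real \<Rightarrow> real" where "k1 m l = m / 4 * (l - 1 / l)"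

definition lax_V ::
    "real \<Rightarrow> real \<Rightarrow> (real \<Rightarrow> real) \<Rightarrow> (real \<Rightarrow> real) \<Rightarrow> real \<Rightarrow> real \<Rightarrow> complex^2^2" where
  "lax_V m \<beta> u p l t =
     (\<i> * of_real (\<beta> / 4 * p t)) \<odot> pauli3
     - (\<i> * of_real (k1 m l * sin (\<beta> * u t / 2))) \<odot> pauli1
     - (\<i> * of_real (k0 m l * cos (\<beta> * u t / 2))) \<odot> pauli2"

definition transition_matrix :: "(real \<Rightarrow> complex^2^2) \<Rightarrow> (real \<Rightarrow> real \<Rightarrow> complex^2^2) \<Rightarrow> bool" where
  "transition_matrix V T \<longleftrightarrow>
     (\<forall>\<tau> t. ((\<lambda>s. T s \<tau>) has_vector_derivative V t ** T t \<tau>) (at t)) \<and> (\<forall>\<tau>. T \<tau> \<tau> = mat 1)"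

definition N_mat :: "complex^2^2" where
  "N_mat = of_real (1 / sqrt 2) \<odot> (mat 1 + \<i> \<odot> pauli1)"

definition E_mat :: "real \<Rightarrow> int \<Rightarrow> real \<Rightarrow> real \<Rightarrow> complex^2^2" where
  "E_mat m Q l t =
     exp_pauli3 (\<i> * of_real (pi / 2 * of_int Q)) ** N_mat ** exp_pauli3 (- \<i> * of_real (k0 m l * t))"

definition is_time_monodromy ::
    "real \<Rightarrow> real \<Rightarrow> int \<Rightarrow> int \<Rightarrow> (real \<Rightarrow> real) \<Rightarrow> (real \<Rightarrow> real) \<Rightarrow> real \<Rightarrow> complex^2^2 \<Rightarrow> bool" where
  "is_time_monodromy m \<beta> Qm Qp u p l M \<longleftrightarrow>
     (\<exists>T. transition_matrix (lax_V m \<beta> u p l) T \<and>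
        ((\<lambda>(t, \<tau>). matrix_inv (E_mat m Qp l t) ** T t \<tau> ** E_mat m Qm l \<tau>) \<longlongrightarrow> M)
          (at_top \<times>\<^sub>F at_bot))"

text \<open>\<open>J\<close> is the family of coefficients \<open>J\<^sub>n\<close>. The spectral parameter is real, so the filter
  \<open>at_infinity\<close> covers both ends of the line. The logarithm is any \<open>L\<close> with \<open>exp L = a\<close> near the
  limit point; the expansion itself forces the branch, by \<open>L \<rightarrow> 0\<close> at infinity and by
  \<open>L \<rightarrow> \<i> J\<^sub>0\<close> at \<open>0\<close>, with \<open>J\<^sub>0\<close> prescribed.\<close>

definition time_integrals ::
    "real \<Rightarrow> real \<Rightarrow> int \<Rightarrow> int \<Rightarrow> (real \<Rightarrow> real) \<Rightarrow> (real \<Rightarrow> real) \<Rightarrow> (int \<Rightarrow> complex) \<Rightarrow> bool" where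
  "time_integrals m \<beta> Qm Qp u p J \<longleftrightarrow>
     (\<exists>a :: real \<Rightarrow> complex.
        (\<forall>l. l \<noteq> 0 \<longrightarrow> (\<exists>M. is_time_monodromy m \<beta> Qm Qp u p l M \<and> a l = M $ 1 $ 1)) \<and>
        (\<exists>L. (\<forall>\<^sub>F l in at_infinity. exp (L l) = a l) \<and>
             (\<forall>N. (\<lambda>l. L l - \<i> * (\<Sum>n = 1..N. J (int n) / of_real l ^ n))
                    \<in> o[at_infinity](\<lambda>l. 1 / of_real l ^ N))) \<and>
        (\<exists>L. (\<forall>\<^sub>F l in at 0. exp (L l) = a l) \<and>
             (\<forall>N. (\<lambda>l. L l - \<i> * (\<Sum>n = 0..N. J (- int n) * of_real l ^ n))
                    \<in> o[at 0](\<lambda>l. of_real l ^ N))) \<and>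
        J 0 = of_real (- \<beta> / 2 * (Lim at_top u - Lim at_bot u)))"

text \<open>The integrals of \<open>(v, q)\<close> (tilde side) are those of \<open>(u, p)\<close> up to the constants \<open>E n\<close>. The
  first conjunct says that they are defined on one side iff they are on the other.\<close>

definition integrals_shifted_by ::
    "real \<Rightarrow> real \<Rightarrow> int \<Rightarrow> int \<Rightarrow> int \<Rightarrow> int \<Rightarrow> (int \<Rightarrow> complex) \<Rightarrow>
     (real \<Rightarrow> real) \<times> (real \<Rightarrow> real) \<Rightarrow> (real \<Rightarrow> real) \<times> (real \<Rightarrow> real) \<Rightarrow> bool" where
  "integrals_shifted_by m \<beta> Qm Qp Qtm Qtp E = (\<lambda>(u, p) (v, q).
     ((\<exists>J. time_integrals m \<beta> Qm Qp u p J) \<longleftrightarrow> (\<exists>Jt. time_integrals m \<beta> Qtm Qtp v q Jt)) \<and>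
     (\<forall>J Jt. time_integrals m \<beta> Qm Qp u p J \<longrightarrow> time_integrals m \<beta> Qtm Qtp v q Jt \<longrightarrow>
        (\<forall>n. Jt n = J n + E n)))"


section \<open>Canonical transformations for the equal-space bracket\<close>

text \<open>\<open>\<integral>(\<Pi> d\<phi> - \<Pi>\<^sup>~ d\<phi>\<^sup>~) dt = dS\<close> along the transformation \<open>R\<close>, evaluated on an arbitrary joint
  variation \<open>(h, k)\<close> of the two fields.\<close>

definition generating_functional ::
    "real \<Rightarrow> int \<Rightarrow> int \<Rightarrow> int \<Rightarrow> int \<Rightarrow>
     ((real \<Rightarrow> real) \<times> (real \<Rightarrow> real) \<Rightarrow> (real \<Rightarrow> real) \<times> (real \<Rightarrow> real) \<Rightarrow> bool) \<Rightarrow>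
     ((real \<Rightarrow> real) \<Rightarrow> (real \<Rightarrow> real) \<Rightarrow> real) \<Rightarrow> bool" where
  "generating_functional \<beta> Qm Qp Qtm Qtp R S \<longleftrightarrow>
     (\<forall>(u, p) \<in> phase_space \<beta> Qm Qp. \<forall>(v, q) \<in> phase_space \<beta> Qtm Qtp. R (u, p) (v, q) \<longrightarrow>
        (\<forall>h k. schwartz h \<longrightarrow> schwartz k \<longrightarrow>
           integrable lborel (\<lambda>t. p t * h t - q t * k t) \<and>
           ((\<lambda>\<epsilon>. S (\<lambda>t. u t + \<epsilon> * h t) (\<lambda>t. v t + \<epsilon> * k t))
              has_real_derivative (LBINT t. p t * h t - q t * k t)) (at 0)))"

text \<open>The first conjunct expresses that the two fields are the functionally independent variables:
  any two of them are allowed, and the transformation determines the two momenta.\<close>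

definition canonical_transformation ::
    "real \<Rightarrow> real \<Rightarrow> int \<Rightarrow> int \<Rightarrow> int \<Rightarrow> int \<Rightarrow>
     ((real \<Rightarrow> real) \<times> (real \<Rightarrow> real) \<Rightarrow> (real \<Rightarrow> real) \<times> (real \<Rightarrow> real) \<Rightarrow> bool) \<Rightarrow> bool" where
  "canonical_transformation m \<beta> Qm Qp Qtm Qtp R \<longleftrightarrow>
     (\<forall>u v. field_boundary \<beta> Qm Qp u \<longrightarrow> field_boundary \<beta> Qtm Qtp v \<longrightarrow>
        (\<exists>!(p, q). schwartz p \<and> schwartz q \<and> R (u, p) (v, q))) \<and>
     (\<exists>S. generating_functional \<beta> Qm Qp Qtm Qtp R S) \<and>
     (\<exists>E. \<forall>w \<in> phase_space \<beta> Qm Qp. \<forall>wt \<in> phase_space \<beta> Qtm Qtp. R w wt \<longrightarrow>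
        integrals_shifted_by m \<beta> Qm Qp Qtm Qtp E w wt)"

end

theory Submission
  imports Defs "HOL-Probability.Sinc_Integral"
begin

text \<open>Solved for the momenta, the defect conditions express \<open>\<Pi>\<close> and \<open>\<Pi>\<^sup>~\<close> as Schwartz functions of the
  two fields, because \<open>\<beta> (\<phi>\<^sup>~ \<plusminus> \<phi>) / 2\<close> tends to multiples of \<open>\<pi>\<close>; they are the partial
  variations of \<open>S_T\<close>, whose second-order remainder is bounded by \<open>\<epsilon>\<^sup>2\<close> times an integrable
  function. Conversely, two Schwartz functional derivatives coincide, as one sees by varying along
  their difference.

  For the integrals, the defect conditions make the matrix
  \<open>K = ((l e^(i(\<theta>\<^sup>~-\<theta>)/2), \<sigma> e^(-i(\<theta>\<^sup>~+\<theta>)/2)), (-\<sigma> e^(i(\<theta>\<^sup>~+\<theta>)/2), l e^(-i(\<theta>\<^sup>~-\<theta>)/2)))\<close> with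
  \<open>\<theta> = \<beta> \<phi> / 2\<close> a gauge transformation between the two linear problems:
  \<open>K' = V\<^sup>~ K - K V\<close>. In the vacuum frames at the ends of the time axis, \<open>K\<close> becomes the diagonal
  matrix \<open>l + i \<epsilon> \<sigma> \<sigma>\<^sub>3\<close> with \<open>\<epsilon> = (-1)^(Q + Q\<^sup>~)\<close>, hence
  \<open>a\<^sup>~ = a (l + i \<epsilon>\<^sub>+ \<sigma>) / (l + i \<epsilon>\<^sub>- \<sigma>)\<close>. The logarithm of the quotient is independent of the
  fields and has power series at both ends of the spectrum. Exchanging the two sides amounts to
  \<open>\<sigma> \<mapsto> -\<sigma>\<close>, which gives the converse direction.\<close>


section \<open>Schwartz functions on the line\<close>

text \<open>Rapid decay alone, with no regularity attached: it also has to apply to the difference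
  between a field and the discontinuous \<open>field_vacuum\<close>.\<close>

definition decays :: "(real \<Rightarrow> real) \<Rightarrow> bool" where
  "decays g \<longleftrightarrow> (\<forall>N. ((\<lambda>t. t ^ N * g t) \<longlongrightarrow> 0) at_bot \<and> ((\<lambda>t. t ^ N * g t) \<longlongrightarrow> 0) at_top)"

lemma decays_add: "decays f \<Longrightarrow> decays g \<Longrightarrow> decays (\<lambda>t. f t + g t)"
  unfolding decays_def by (auto simp: distrib_left intro!: tendsto_add_zero)

lemma decays_cmult:
  assumes "decays f" shows "decays (\<lambda>t. c * f t)"
proof -
  have eq: "t ^ N * (c * f t) = c * (t ^ N * f t)" for t N by simp
  show ?thesis using assms unfolding decays_def eq by (auto intro!: tendsto_mult_right_zero)
qed

lemma decays_bound:
  assumes f: "decays f" and g: "\<And>t. \<bar>g t\<bar> \<le> C * \<bar>f t\<bar>"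
  shows "decays g"
proof -
  have *: "((\<lambda>t. t ^ N * g t) \<longlongrightarrow> 0) F" if "((\<lambda>t. t ^ N * f t) \<longlongrightarrow> 0) F" for F N
  proof (rule Lim_null_comparison)
    show "\<forall>\<^sub>F t in F. norm (t ^ N * g t) \<le> C * \<bar>t ^ N * f t\<bar>"
      using mult_left_mono[OF g, of "\<bar>t ^ N\<bar>" for t]
      by (intro always_eventually) (auto simp: abs_mult ac_simps)
    show "((\<lambda>t. C * \<bar>t ^ N * f t\<bar>) \<longlongrightarrow> 0) F"
      using that by (intro tendsto_mult_right_zero tendsto_rabs_zero)
  qed
  then show ?thesis using f unfolding decays_def by blast
qed

text \<open>Closure of \<open>A\<close> under differentiation puts every
  \<open>(deriv ^^ k) f\<close> into \<open>A\<close>, where decay is assumed. Later proofs exhibit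
  such a class instead of controlling iterated derivatives.\<close>

lemma schwartz_coinduct:
  assumes "f \<in> A"
    and dec: "\<And>g. g \<in> A \<Longrightarrow> decays g"
    and der: "\<And>g. g \<in> A \<Longrightarrow> \<exists>g'\<in>A. \<forall>t. (g has_real_derivative g' t) (at t)"
  shows "schwartz f"
proof -
  have "deriv g \<in> A" if "g \<in> A" for g
    using der[OF that] by (metis DERIV_imp_deriv ext)
  then have iter: "(deriv ^^ k) f \<in> A" for k
    using \<open>f \<in> A\<close> by (induction k) auto
  then have "smooth f"
    unfolding smooth_def using der real_differentiable_def by blast
  then show ?thesis
    using dec[OF iter] by (auto simp: schwartz_def schwartz_limit_def decays_def)
qed

lemma schwartz_decays: "schwartz f \<Longrightarrow> decays f"
  unfolding schwartz_def schwartz_limit_def decays_def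
  by (elim conjE, drule spec[of _ 0], drule spec[of _ 0]) simp

lemma smooth_DERIV: "smooth f \<Longrightarrow> (f has_real_derivative deriv f t) (at t)"
  unfolding smooth_def
  by (drule spec[of _ 0]) (simp add: DERIV_deriv_iff_real_differentiable)

lemma smooth_deriv: "smooth f \<Longrightarrow> smooth (deriv f)"
  unfolding smooth_def
  by (rule allI, drule_tac x = "Suc k" in spec) (simp add: funpow_swap1)

lemma schwartz_DERIV: "schwartz f \<Longrightarrow> (f has_real_derivative deriv f t) (at t)"
  by (simp add: schwartz_def smooth_DERIV)

lemma schwartz_deriv:
  assumes "schwartz f" shows "schwartz (deriv f)"
proof -
  have "(deriv ^^ k) (deriv f) = (deriv ^^ Suc k) f" for k
    by (simp add: funpow_swap1)
  then show ?thesis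
    using assms by (simp add: schwartz_def schwartz_limit_def smooth_deriv del: funpow.simps)
qed

text \<open>The class consists of \<open>f\<close> and all Schwartz functions. This reduces the sine
  of a phase to its derivative, in which a Schwartz factor appears.\<close>

lemma schwartz_step:
  assumes "decays f" and "\<And>t. (f has_real_derivative f' t) (at t)" and "schwartz f'"
  shows "schwartz f"
proof (rule schwartz_coinduct[of _ "insert f (Collect schwartz)"])
  fix g assume g: "g \<in> insert f (Collect schwartz)"
  then show "decays g" using assms(1) schwartz_decays by auto
  show "\<exists>g'\<in>insert f (Collect schwartz). \<forall>t. (g has_real_derivative g' t) (at t)"
  proof (cases "g = f")
    case True
    then show ?thesis using assms(2,3) by auto
  next
    case False
    then show ?thesis using g by (auto intro!: bexI[of _ "deriv g"] schwartz_DERIV schwartz_deriv)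
  qed
qed simp

lemma schwartz_0: "schwartz (\<lambda>t. 0)"
  by (rule schwartz_coinduct[of _ "{\<lambda>t. 0}"]) (auto simp: decays_def)

lemma schwartz_lincomb:
  assumes "schwartz f" "schwartz g"
  shows "schwartz (\<lambda>t. a * f t + b * g t)"
proof (rule schwartz_coinduct[of _ "{\<lambda>t. a * f t + b * g t | f g. schwartz f \<and> schwartz g}"])
  show "(\<lambda>t. a * f t + b * g t) \<in> {\<lambda>t. a * f t + b * g t | f g. schwartz f \<and> schwartz g}"
    using assms by blast
next
  fix w assume "w \<in> {\<lambda>t. a * f t + b * g t | f g. schwartz f \<and> schwartz g}"
  then obtain f g where w: "w = (\<lambda>t. a * f t + b * g t)" and fg: "schwartz f" "schwartz g" by blast
  show "decays w" unfolding w by (intro decays_add decays_cmult schwartz_decays fg)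
  have "\<forall>t. (w has_real_derivative a * deriv f t + b * deriv g t) (at t)"
    unfolding w by (auto intro!: derivative_eq_intros schwartz_DERIV fg)
  then show "\<exists>w'\<in>{\<lambda>t. a * f t + b * g t | f g. schwartz f \<and> schwartz g}.
               \<forall>t. (w has_real_derivative w' t) (at t)"
    using schwartz_deriv[OF fg(1)] schwartz_deriv[OF fg(2)]
    by (intro bexI[of _ "\<lambda>t. a * deriv f t + b * deriv g t"]) auto
qed

lemma schwartz_add: "schwartz f \<Longrightarrow> schwartz g \<Longrightarrow> schwartz (\<lambda>t. f t + g t)"
  using schwartz_lincomb[of f g 1 1] by simp

lemma schwartz_diff: "schwartz f \<Longrightarrow> schwartz g \<Longrightarrow> schwartz (\<lambda>t. f t - g t)"
  using schwartz_lincomb[of f g 1 "-1"] by simp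

lemma schwartz_cmult: "schwartz f \<Longrightarrow> schwartz (\<lambda>t. c * f t)"
  using schwartz_lincomb[of f f c 0] by simp

lemma schwartz_uminus: "schwartz f \<Longrightarrow> schwartz (\<lambda>t. - f t)"
  using schwartz_cmult[of f "-1"] by simp

text \<open>The module over the Schwartz functions generated by \<open>F\<close>. The Schwartz
  coefficients supply the decay, so bounded generators such as sines and cosines suffice.\<close>

inductive_set module_span :: "(real \<Rightarrow> real) set \<Rightarrow> (real \<Rightarrow> real) set" for F where
  gen: "schwartz g \<Longrightarrow> f \<in> F \<Longrightarrow> (\<lambda>t. g t * f t) \<in> module_span F"
| add: "a \<in> module_span F \<Longrightarrow> b \<in> module_span F \<Longrightarrow> (\<lambda>t. a t + b t) \<in> module_span F"

text \<open>The hypothesis on \<open>g * f'\<close> is weaker than \<open>f' \<in> F\<close>, which lets it serve both products and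
  the trigonometric functions.\<close>

lemma schwartz_module_span:
  assumes bdd: "\<And>f. f \<in> F \<Longrightarrow> \<exists>B. \<forall>t. \<bar>f t\<bar> \<le> B"
    and der: "\<And>f g. f \<in> F \<Longrightarrow> schwartz g \<Longrightarrow>
        \<exists>f'. (\<forall>t. (f has_real_derivative f' t) (at t)) \<and> (\<lambda>t. g t * f' t) \<in> module_span F"
    and w: "w \<in> module_span F"
  shows "schwartz w"
proof (rule schwartz_coinduct[of _ "module_span F"])
  fix a assume "a \<in> module_span F"
  then show "decays a"
  proof induction
    case (gen g f)
    obtain B where B: "\<bar>f t\<bar> \<le> B" for t using bdd[OF gen(2)] by blast
    show ?case
      by (rule decays_bound[OF schwartz_decays[OF gen(1)], of _ B])
         (simp add: abs_mult mult.commute mult_right_mono[OF B])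
  qed (rule decays_add)
next
  fix a assume "a \<in> module_span F"
  then show "\<exists>a'\<in>module_span F. \<forall>t. (a has_real_derivative a' t) (at t)"
  proof induction
    case (gen g f)
    obtain f' where f': "\<And>t. (f has_real_derivative f' t) (at t)"
      and mem: "(\<lambda>t. g t * f' t) \<in> module_span F"
      using der[OF gen(2,1)] by blast
    have "((\<lambda>t. g t * f t) has_real_derivative deriv g t * f t + g t * f' t) (at t)" for t
      using DERIV_mult[OF schwartz_DERIV[OF gen(1), of t] f'[of t]] by (simp add: ac_simps)
    then show ?case
      using module_span.add[OF module_span.gen[OF schwartz_deriv[OF gen(1)] gen(2)] mem]
      by (intro bexI[of _ "\<lambda>t. deriv g t * f t + g t * f' t"]) auto
  next
    case (add a b)
    then obtain a' b' where "a' \<in> module_span F" "b' \<in> module_span F"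
      "\<forall>t. (a has_real_derivative a' t) (at t)" "\<forall>t. (b has_real_derivative b' t) (at t)" by blast
    then show ?case
      using module_span.add[of a' F b']
      by (intro bexI[of _ "\<lambda>t. a' t + b' t"]) (auto intro: DERIV_add)
  qed
qed (rule w)

section \<open>Bounded multipliers, products and sines\<close>

lemma bounded_if_limits:
  fixes f :: "real \<Rightarrow> real"
  assumes cont: "\<And>t. isCont f t" and bot: "(f \<longlongrightarrow> a) at_bot" and top: "(f \<longlongrightarrow> b) at_top"
  shows "\<exists>B. \<forall>t. \<bar>f t\<bar> \<le> B"
proof -
  have "\<forall>\<^sub>F t in at_bot. \<bar>f t - a\<bar> < 1" "\<forall>\<^sub>F t in at_top. \<bar>f t - b\<bar> < 1"
    using tendstoD[OF bot, of 1] tendstoD[OF top, of 1] by (auto simp: dist_real_def)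
  then obtain l r where l: "\<And>t. t \<le> l \<Longrightarrow> \<bar>f t - a\<bar> < 1" and r: "\<And>t. t \<ge> r \<Longrightarrow> \<bar>f t - b\<bar> < 1"
    unfolding eventually_at_bot_linorder eventually_at_top_linorder by blast
  have "compact (f ` {l..r})"
    by (intro compact_continuous_image continuous_at_imp_continuous_on) (auto simp: cont)
  then obtain C where C: "\<And>t. t \<in> {l..r} \<Longrightarrow> \<bar>f t\<bar> \<le> C"
    using compact_imp_bounded bounded_iff by (metis image_eqI real_norm_def)
  have "\<bar>f t\<bar> \<le> max C (max (\<bar>a\<bar> + 1) (\<bar>b\<bar> + 1))" for t
    using l[of t] r[of t] C[of t] by (cases "t \<le> l"; cases "t \<ge> r") auto
  then show ?thesis by blast
qed

lemma schwartz_isCont: "schwartz f \<Longrightarrow> isCont f t"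
  using schwartz_DERIV DERIV_isCont by blast

lemma decays_tendsto_0: "decays f \<Longrightarrow> (f \<longlongrightarrow> 0) at_bot" "decays f \<Longrightarrow> (f \<longlongrightarrow> 0) at_top"
  unfolding decays_def by (drule spec[of _ 0], simp)+

lemma schwartz_bounded: "schwartz f \<Longrightarrow> \<exists>B. \<forall>t. \<bar>f t\<bar> \<le> B"
  using bounded_if_limits schwartz_isCont decays_tendsto_0 schwartz_decays by blast

text \<open>A field with non-zero limits in time is not Schwartz, but it is bounded with Schwartz
  derivative. That is enough to multiply it with a variation.\<close>

lemma schwartz_mult:
  assumes "schwartz g" and "\<exists>B. \<forall>t. \<bar>f t\<bar> \<le> B"
    and "\<And>t. (f has_real_derivative deriv f t) (at t)" and "schwartz (deriv f)"
  shows "schwartz (\<lambda>t. g t * f t)"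
proof -
  \<comment> \<open>\<open>F\<close> contains every Schwartz function, in particular the derivatives
    of its own members, so the module is closed under differentiation.\<close>
  define F where "F = {f. (\<exists>B. \<forall>t. \<bar>f t\<bar> \<le> B) \<and>
    (\<forall>t. (f has_real_derivative deriv f t) (at t)) \<and> schwartz (deriv f)}"
  have F: "g \<in> F" if "schwartz g" for g
    unfolding F_def using that schwartz_bounded schwartz_DERIV schwartz_deriv by blast
  have "(\<lambda>t. g t * f t) \<in> module_span F"
    using assms by (auto simp: F_def intro: module_span.gen)
  then show ?thesis
  proof (rule schwartz_module_span[rotated 2])
    fix f g assume "f \<in> F" and g: "schwartz g"
    then show "\<exists>f'. (\<forall>t. (f has_real_derivative f' t) (at t)) \<and> (\<lambda>t. g t * f' t) \<in> module_span F"
      using module_span.gen[OF g F[of "deriv f"]] by (auto simp: F_def)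
  qed (auto simp: F_def)
qed

lemma schwartz_mult_schwartz: "schwartz f \<Longrightarrow> schwartz g \<Longrightarrow> schwartz (\<lambda>t. f t * g t)"
  by (intro schwartz_mult schwartz_bounded schwartz_DERIV schwartz_deriv)

lemma abs_sin_diff_le: "\<bar>sin x - sin y\<bar> \<le> \<bar>x - (y :: real)\<bar>"
proof -
  have "\<bar>sin x - sin y\<bar> = \<bar>2 * sin ((x - y) / 2) * cos ((x + y) / 2)\<bar>"
    by (simp add: sin_diff_sin)
  also have "\<dots> \<le> 2 * \<bar>(x - y) / 2\<bar> * 1"
    unfolding abs_mult using abs_sin_x_le_abs_x[of "(x - y) / 2"] by (intro mult_mono) auto
  finally show ?thesis by simp
qed

lemma abs_cos_diff_le: "\<bar>cos x - cos y\<bar> \<le> \<bar>x - (y :: real)\<bar>"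
  using abs_sin_diff_le[of "pi / 2 - x" "pi / 2 - y"] by (simp add: sin_diff)

text \<open>Decay has to be supplied for the sine itself only: its derivative carries the Schwartz
  factor \<open>w'\<close>, next to which boundedness of the sine and cosine is enough.\<close>

lemma schwartz_sin:
  assumes w: "\<And>t. (w has_real_derivative w' t) (at t)" and w': "schwartz w'"
    and dec: "decays (\<lambda>t. sin (w t))"
  shows "schwartz (\<lambda>t. sin (w t))"
proof (rule schwartz_step[OF dec])
  show "((\<lambda>t. sin (w t)) has_real_derivative w' t * cos (w t)) (at t)" for t
    by (rule derivative_eq_intros w refl | simp)+
  \<comment> \<open>Differentiation exchanges the two generators up to sign and a factor
    \<open>w'\<close>, which is absorbed into the Schwartz coefficient.\<close>
  define F where "F = {\<lambda>t. sin (w t), \<lambda>t. cos (w t)}"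
  have "(\<lambda>t. w' t * cos (w t)) \<in> module_span F"
    by (intro module_span.gen w') (simp add: F_def)
  then show "schwartz (\<lambda>t. w' t * cos (w t))"
  proof (rule schwartz_module_span[rotated 2])
    fix f assume "f \<in> F" then show "\<exists>B. \<forall>t. \<bar>f t\<bar> \<le> B"
      unfolding F_def by (intro exI[of _ 1]) auto
  next
    fix f g assume f: "f \<in> F" and g: "schwartz g"
    have gw: "schwartz (\<lambda>t. g t * w' t)" by (rule schwartz_mult_schwartz[OF g w'])
    have s: "(\<lambda>t. g t * (w' t * cos (w t))) \<in> module_span F"
      using module_span.gen[OF gw, of "\<lambda>t. cos (w t)" F] by (simp add: F_def ac_simps)
    have c: "(\<lambda>t. g t * (- w' t * sin (w t))) \<in> module_span F"
      using module_span.gen[OF schwartz_uminus[OF gw], of "\<lambda>t. sin (w t)" F] by (simp add: F_def ac_simps)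
    have ds: "((\<lambda>t. sin (w t)) has_real_derivative w' t * cos (w t)) (at t)"
      and dc: "((\<lambda>t. cos (w t)) has_real_derivative - w' t * sin (w t)) (at t)" for t
      by (rule derivative_eq_intros w refl | simp)+
    from f consider "f = (\<lambda>t. sin (w t))" | "f = (\<lambda>t. cos (w t))" unfolding F_def by blast
    then show "\<exists>f'. (\<forall>t. (f has_real_derivative f' t) (at t)) \<and> (\<lambda>t. g t * f' t) \<in> module_span F"
    proof cases
      case 1 then show ?thesis using s ds by (intro exI[of _ "\<lambda>t. w' t * cos (w t)"]) simp
    next
      case 2 then show ?thesis using c dc by (intro exI[of _ "\<lambda>t. - w' t * sin (w t)"]) simp
    qed
  qed
qed

text \<open>Comparison with \<open>1 / (1 + t^2)\<close>: decay of \<open>t^2 * f\<close> controls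
  the tails and \<open>B\<close> the compact rest. Measurability takes the place of continuity
  because \<open>field_vacuum\<close> jumps at 0.\<close>

lemma integrable_if_decays:
  assumes meas: "f \<in> borel_measurable borel" and B: "\<And>t. \<bar>f t\<bar> \<le> B" and dec: "decays f"
  shows "integrable lborel f"
proof -
  have "((\<lambda>t. t\<^sup>2 * f t) \<longlongrightarrow> 0) at_bot" "((\<lambda>t. t\<^sup>2 * f t) \<longlongrightarrow> 0) at_top"
    using dec by (auto simp: decays_def)
  then have "\<forall>\<^sub>F t in at_bot. \<bar>t\<^sup>2 * f t\<bar> < 1" "\<forall>\<^sub>F t in at_top. \<bar>t\<^sup>2 * f t\<bar> < 1"
    using tendstoD[of "\<lambda>t. t\<^sup>2 * f t" 0 _ 1] by (auto simp: dist_real_def)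
  then obtain l r where l: "\<And>t. t \<le> l \<Longrightarrow> \<bar>t\<^sup>2 * f t\<bar> < 1" and r: "\<And>t. t \<ge> r \<Longrightarrow> \<bar>t\<^sup>2 * f t\<bar> < 1"
    unfolding eventually_at_bot_linorder eventually_at_top_linorder by blast
  \<comment> \<open>\<open>C\<close> bounds \<open>(1 + t^2) * |f t|\<close>:
    \<open>t^2 * |f t|\<close> is below 1 on the tails and at most
    \<open>max (l^2) (r^2) * B\<close> between \<open>l\<close> and \<open>r\<close>; the last
    \<open>B\<close> belongs to the summand 1.\<close>
  define C where "C = max 1 (max (l\<^sup>2) (r\<^sup>2) * B) + B"
  have B0: "B \<ge> 0" using B[of 0] by linarith
  have "norm (f t) \<le> norm (C * inverse (1 + t\<^sup>2))" for t
  proof -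
    have "\<bar>t\<^sup>2 * f t\<bar> \<le> max 1 (max (l\<^sup>2) (r\<^sup>2) * B)"
    proof (cases "t \<le> l \<or> t \<ge> r")
      case True then show ?thesis using l[of t] r[of t] by auto
    next
      case False
      have "t\<^sup>2 \<le> max (l\<^sup>2) (r\<^sup>2)"
      proof (cases "t \<ge> 0")
        case True then have "t\<^sup>2 \<le> r\<^sup>2" using False by (intro power_mono) auto
        then show ?thesis by simp
      next
        case neg: False then have "(-t)\<^sup>2 \<le> (-l)\<^sup>2" using False by (intro power_mono) auto
        then show ?thesis by simp
      qed
      then have "t\<^sup>2 * \<bar>f t\<bar> \<le> max (l\<^sup>2) (r\<^sup>2) * B" using B[of t] B0
        by (intro mult_mono) (auto intro: max.coboundedI1)
      then show ?thesis by (simp add: abs_mult)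
    qed
    then have "(1 + t\<^sup>2) * \<bar>f t\<bar> \<le> C" using B[of t] by (simp add: C_def algebra_simps abs_mult)
    moreover have "1 + t\<^sup>2 > 0" by (simp add: add_pos_nonneg)
    ultimately have "\<bar>f t\<bar> \<le> C / (1 + t\<^sup>2)" by (simp add: pos_le_divide_eq mult.commute)
    also have "\<dots> \<le> \<bar>C * inverse (1 + t\<^sup>2)\<bar>" by (simp add: divide_inverse)
    finally show ?thesis by simp
  qed
  moreover have "integrable lborel (\<lambda>t. C * inverse (1 + t\<^sup>2) :: real)"
    using integrable_inverse_1_plus_square by (simp add: set_integrable_def)
  ultimately show ?thesis
    using meas by (intro Bochner_Integration.integrable_bound[of lborel "\<lambda>t. C * inverse (1 + t\<^sup>2)" f]) auto
qed

lemma borel_measurable_isCont: "(\<And>t. isCont f t) \<Longrightarrow> f \<in> borel_measurable borel"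
  for f :: "real \<Rightarrow> real"
  by (intro borel_measurable_continuous_onI continuous_at_imp_continuous_on) auto

lemma schwartz_integrable: "schwartz f \<Longrightarrow> integrable lborel f"
  using schwartz_bounded integrable_if_decays borel_measurable_isCont schwartz_isCont schwartz_decays
  by metis

text \<open>Used to discard the total time derivative in the variation of the action.\<close>

lemma integral_deriv_schwartz:
  assumes f: "schwartz f"
  shows "(LBINT t. deriv f t) = 0"
proof -
  have "(LBINT t=-\<infinity>..\<infinity>. deriv f t) = 0 - 0"
  proof (rule interval_integral_FTC_integrable[where F = f])
    show "(f has_vector_derivative deriv f t) (at t)" for t
      using schwartz_DERIV[OF f] by (simp add: has_real_derivative_iff_has_vector_derivative)
    show "isCont (deriv f) t" for t by (rule schwartz_isCont[OF schwartz_deriv[OF f]])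
    show "set_integrable lborel (einterval (-\<infinity>) \<infinity>) (deriv f)"
      using schwartz_integrable[OF schwartz_deriv[OF f]] by (simp add: set_integrable_def)
    show "((f \<circ> real_of_ereal) \<longlongrightarrow> 0) (at_right (-\<infinity>))" "((f \<circ> real_of_ereal) \<longlongrightarrow> 0) (at_left \<infinity>)"
      using decays_tendsto_0[OF schwartz_decays[OF f]] by (simp_all add: ereal_tendsto_simps)
  qed auto
  then show ?thesis by (simp add: interval_integral_to_infinity_eq interval_lebesgue_integral_def set_lebesgue_integral_def)
qed


section \<open>The defect action\<close>

text \<open>The step profile at which \<open>L_vacuum\<close> evaluates the defect potential. Naming
  it turns the subtraction in \<open>S_T\<close> into a difference of the same expression at two
  field configurations.\<close>

definition field_vacuum :: "real \<Rightarrow> int \<Rightarrow> int \<Rightarrow> real \<Rightarrow> real" where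
  "field_vacuum \<beta> Qm Qp t = (if t < 0 then 2 * pi * of_int Qm / \<beta> else 2 * pi * of_int Qp / \<beta>)"

lemma L_vacuum_eq:
  "L_vacuum m \<beta> \<sigma> Qm Qp Qtm Qtp t = - defect_B m \<beta> \<sigma> (field_vacuum \<beta> Qm Qp t) (field_vacuum \<beta> Qtm Qtp t)"
  by (simp add: L_vacuum_def field_vacuum_def)

lemma borel_measurable_field_vacuum [measurable]: "field_vacuum \<beta> Qm Qp \<in> borel_measurable borel"
  unfolding field_vacuum_def by measurable

section \<open>Fields with prescribed limits in time\<close>

lemma field_boundary_DERIV: "field_boundary \<beta> Qm Qp u \<Longrightarrow> (u has_real_derivative deriv u t) (at t)"
  by (simp add: field_boundary_def smooth_DERIV)

lemma field_boundary_isCont: "field_boundary \<beta> Qm Qp u \<Longrightarrow> isCont u t"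
  using field_boundary_DERIV DERIV_isCont by blast

text \<open>The constant \<open>c\<close> disappears with the first derivative, so the conditions on
  \<open>deriv u\<close> are those on \<open>u - c\<close> shifted by one order.\<close>

lemma schwartz_limit_deriv:
  assumes u: "smooth u" and lim: "schwartz_limit F u c"
  shows "schwartz_limit F (deriv u) 0"
proof -
  have "deriv (\<lambda>s. u s - c) = deriv u"
    using smooth_DERIV[OF u] by (intro ext DERIV_imp_deriv) (auto intro!: derivative_eq_intros)
  then have "(deriv ^^ Suc k) (\<lambda>s. u s - c) = (deriv ^^ k) (deriv u)" for k
    by (simp add: funpow_Suc_right del: funpow.simps)
  then show ?thesis
    using lim unfolding schwartz_limit_def diff_zero by metis
qed

lemma schwartz_limit_tendsto:
  assumes "schwartz_limit F u c"
  shows "((\<lambda>t. t ^ N * (u t - c)) \<longlongrightarrow> 0) F" and "(u \<longlongrightarrow> c) F"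
proof -
  have *: "((\<lambda>t. t ^ N * (u t - c)) \<longlongrightarrow> 0) F" for N
    using assms unfolding schwartz_limit_def by (elim allE[of _ 0] allE[of _ N]) simp
  show "((\<lambda>t. t ^ N * (u t - c)) \<longlongrightarrow> 0) F" by (rule *)
  show "(u \<longlongrightarrow> c) F" using *[of 0] by (simp add: LIM_zero_iff)
qed

lemma field_boundary_schwartz_deriv: "field_boundary \<beta> Qm Qp u \<Longrightarrow> schwartz (deriv u)"
  by (auto simp: field_boundary_def schwartz_def smooth_deriv intro: schwartz_limit_deriv)

lemma field_boundary_tendsto:
  assumes "field_boundary \<beta> Qm Qp u"
  shows "(u \<longlongrightarrow> 2 * pi * of_int Qm / \<beta>) at_bot" "(u \<longlongrightarrow> 2 * pi * of_int Qp / \<beta>) at_top"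
  using assms schwartz_limit_tendsto by (auto simp: field_boundary_def)

lemma field_boundary_bounded: "field_boundary \<beta> Qm Qp u \<Longrightarrow> \<exists>B. \<forall>t. \<bar>u t\<bar> \<le> B"
  using bounded_if_limits field_boundary_isCont field_boundary_tendsto by blast

lemma field_boundary_decays:
  assumes "field_boundary \<beta> Qm Qp u"
  shows "decays (\<lambda>t. u t - field_vacuum \<beta> Qm Qp t)"
  unfolding decays_def
proof (intro allI conjI)
  fix N
  have lim: "((\<lambda>t. t ^ N * (u t - 2 * pi * of_int Qm / \<beta>)) \<longlongrightarrow> 0) at_bot"
      "((\<lambda>t. t ^ N * (u t - 2 * pi * of_int Qp / \<beta>)) \<longlongrightarrow> 0) at_top"
    using assms by (auto simp: field_boundary_def intro: schwartz_limit_tendsto)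
  show "((\<lambda>t. t ^ N * (u t - field_vacuum \<beta> Qm Qp t)) \<longlongrightarrow> 0) at_bot"
    by (rule Lim_transform_eventually[OF lim(1)])
       (use eventually_gt_at_bot[of 0] in eventually_elim, simp add: field_vacuum_def)
  show "((\<lambda>t. t ^ N * (u t - field_vacuum \<beta> Qm Qp t)) \<longlongrightarrow> 0) at_top"
    by (rule Lim_transform_eventually[OF lim(2)])
       (use eventually_ge_at_top[of 0] in eventually_elim, simp add: field_vacuum_def)
qed

lemma field_boundary_integrable:
  assumes u: "field_boundary \<beta> Qm Qp u"
  shows "integrable lborel (\<lambda>t. u t - field_vacuum \<beta> Qm Qp t)"
proof -
  have [measurable]: "u \<in> borel_measurable borel"
    using u by (intro borel_measurable_isCont field_boundary_isCont)
  obtain B where B: "\<And>t. \<bar>u t\<bar> \<le> B" using field_boundary_bounded[OF u] by blast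
  let ?C = "B + \<bar>2 * pi * of_int Qm / \<beta>\<bar> + \<bar>2 * pi * of_int Qp / \<beta>\<bar>"
  have "\<bar>u t - field_vacuum \<beta> Qm Qp t\<bar> \<le> ?C" for t
    using B[of t] unfolding field_vacuum_def by (auto simp del: abs_divide abs_mult)
  then show ?thesis
    by (intro integrable_if_decays[OF _ _ field_boundary_decays[OF u]]) auto
qed

lemma schwartz_mult_field: "schwartz h \<Longrightarrow> field_boundary \<beta> Qm Qp u \<Longrightarrow> schwartz (\<lambda>t. h t * u t)"
  by (intro schwartz_mult field_boundary_bounded field_boundary_DERIV field_boundary_schwartz_deriv)

text \<open>In terms of the angles \<theta> = \<beta> \<phi> / 2 on the two sides,
  \<open>half_sum\<close> and \<open>half_diff\<close> are their sum and difference. They are the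
  arguments of the sines in the defect conditions, and their halves are the phases in
  \<open>defect_K\<close>.\<close>

definition half_sum :: "real \<Rightarrow> (real \<Rightarrow> real) \<Rightarrow> (real \<Rightarrow> real) \<Rightarrow> real \<Rightarrow> real" where
  "half_sum \<beta> u v t = \<beta> * (v t + u t) / 2"

definition half_diff :: "real \<Rightarrow> (real \<Rightarrow> real) \<Rightarrow> (real \<Rightarrow> real) \<Rightarrow> real \<Rightarrow> real" where
  "half_diff \<beta> u v t = \<beta> * (v t - u t) / 2"

text \<open>The outer absolute value on the right, around a nonnegative number, gives the shape
  \<open>C * |f t|\<close> that \<open>decays_bound\<close> and the integrability comparison
  expect.\<close>

lemma half_field_diff_le:
  fixes u v u' v' :: "real \<Rightarrow> real"
  shows "\<bar>half_sum \<beta> u v t - half_sum \<beta> u' v' t\<bar> \<le> \<bar>\<beta>\<bar> / 2 * \<bar>\<bar>v t - v' t\<bar> + \<bar>u t - u' t\<bar>\<bar>"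
    and "\<bar>half_diff \<beta> u v t - half_diff \<beta> u' v' t\<bar> \<le> \<bar>\<beta>\<bar> / 2 * \<bar>\<bar>v t - v' t\<bar> + \<bar>u t - u' t\<bar>\<bar>"
proof -
  have "half_sum \<beta> u v t - half_sum \<beta> u' v' t = \<beta> / 2 * ((v t - v' t) + (u t - u' t))"
    "half_diff \<beta> u v t - half_diff \<beta> u' v' t = \<beta> / 2 * ((v t - v' t) - (u t - u' t))"
    by (simp_all add: half_sum_def half_diff_def field_simps)
  then show "\<bar>half_sum \<beta> u v t - half_sum \<beta> u' v' t\<bar> \<le> \<bar>\<beta>\<bar> / 2 * \<bar>\<bar>v t - v' t\<bar> + \<bar>u t - u' t\<bar>\<bar>"
    "\<bar>half_diff \<beta> u v t - half_diff \<beta> u' v' t\<bar> \<le> \<bar>\<beta>\<bar> / 2 * \<bar>\<bar>v t - v' t\<bar> + \<bar>u t - u' t\<bar>\<bar>"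
    by (auto simp only: abs_mult intro!: mult_mono)
qed

lemma sin_half_vacuum:
  assumes "\<beta> \<noteq> 0"
  shows "sin (half_sum \<beta> (field_vacuum \<beta> Qm Qp) (field_vacuum \<beta> Qtm Qtp) t) = 0"
    and "sin (half_diff \<beta> (field_vacuum \<beta> Qm Qp) (field_vacuum \<beta> Qtm Qtp) t) = 0"
proof -
  have "half_sum \<beta> (field_vacuum \<beta> Qm Qp) (field_vacuum \<beta> Qtm Qtp) t
      = of_int (if t < 0 then Qtm + Qm else Qtp + Qp) * pi"
    "half_diff \<beta> (field_vacuum \<beta> Qm Qp) (field_vacuum \<beta> Qtm Qtp) t
      = of_int (if t < 0 then Qtm - Qm else Qtp - Qp) * pi"
    using assms by (auto simp: half_sum_def half_diff_def field_vacuum_def field_simps)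
  then show "sin (half_sum \<beta> (field_vacuum \<beta> Qm Qp) (field_vacuum \<beta> Qtm Qtp) t) = 0"
    "sin (half_diff \<beta> (field_vacuum \<beta> Qm Qp) (field_vacuum \<beta> Qtm Qtp) t) = 0"
    by (metis sin_zero_iff_int2)+
qed

lemma decays_abs: "decays f \<Longrightarrow> decays (\<lambda>t. \<bar>f t\<bar>)"
  by (rule decays_bound[of f _ 1]) auto

text \<open>The sines vanish on the vacuum profiles, and the sine is Lipschitz with constant 1;
  hence they are bounded by the distance of the fields from their vacua, which decays.\<close>

lemma schwartz_sin_half:
  assumes "\<beta> \<noteq> 0" and u: "field_boundary \<beta> Qm Qp u" and v: "field_boundary \<beta> Qtm Qtp v"
  shows "schwartz (\<lambda>t. sin (half_sum \<beta> u v t))" and "schwartz (\<lambda>t. sin (half_diff \<beta> u v t))"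
proof -
  note du = field_boundary_DERIV[OF u] field_boundary_DERIV[OF v]
  note su = field_boundary_schwartz_deriv[OF u] field_boundary_schwartz_deriv[OF v]
  have dec: "decays (\<lambda>t. \<bar>v t - field_vacuum \<beta> Qtm Qtp t\<bar> + \<bar>u t - field_vacuum \<beta> Qm Qp t\<bar>)"
    by (intro decays_add decays_abs field_boundary_decays[OF u] field_boundary_decays[OF v])
  show "schwartz (\<lambda>t. sin (half_sum \<beta> u v t))"
  proof (rule schwartz_sin)
    show "(half_sum \<beta> u v has_real_derivative \<beta> / 2 * deriv v t + \<beta> / 2 * deriv u t) (at t)" for t
      unfolding half_sum_def by (rule derivative_eq_intros du refl | simp add: field_simps)+
    show "schwartz (\<lambda>t. \<beta> / 2 * deriv v t + \<beta> / 2 * deriv u t)" by (intro schwartz_lincomb su)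
    show "decays (\<lambda>t. sin (half_sum \<beta> u v t))"
      using order_trans[OF abs_sin_diff_le half_field_diff_le(1)] sin_half_vacuum[OF \<open>\<beta> \<noteq> 0\<close>]
      by (intro decays_bound[OF dec, of _ "\<bar>\<beta>\<bar> / 2"]) (metis diff_zero)
  qed
  show "schwartz (\<lambda>t. sin (half_diff \<beta> u v t))"
  proof (rule schwartz_sin)
    show "(half_diff \<beta> u v has_real_derivative \<beta> / 2 * deriv v t + (- \<beta> / 2) * deriv u t) (at t)" for t
      unfolding half_diff_def by (rule derivative_eq_intros du refl | simp add: field_simps)+
    show "schwartz (\<lambda>t. \<beta> / 2 * deriv v t + (- \<beta> / 2) * deriv u t)" by (intro schwartz_lincomb su)
    show "decays (\<lambda>t. sin (half_diff \<beta> u v t))"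
      using order_trans[OF abs_sin_diff_le half_field_diff_le(2)] sin_half_vacuum[OF \<open>\<beta> \<noteq> 0\<close>]
      by (intro decays_bound[OF dec, of _ "\<bar>\<beta>\<bar> / 2"]) (metis diff_zero)
  qed
qed

text \<open>The momenta \<open>\<Pi>\<close> and \<open>\<Pi>\<^sup>~\<close> obtained by solving the defect conditions.\<close>

definition defect_p :: "real \<Rightarrow> real \<Rightarrow> real \<Rightarrow> (real \<Rightarrow> real) \<Rightarrow> (real \<Rightarrow> real) \<Rightarrow> real \<Rightarrow> real" where
  "defect_p m \<beta> \<sigma> u v t =
     - deriv v t + m / \<beta> * (\<sigma> * sin (half_sum \<beta> u v t) - 1 / \<sigma> * sin (half_diff \<beta> u v t))"

definition defect_q :: "real \<Rightarrow> real \<Rightarrow> real \<Rightarrow> (real \<Rightarrow> real) \<Rightarrow> (real \<Rightarrow> real) \<Rightarrow> real \<Rightarrow> real" where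
  "defect_q m \<beta> \<sigma> u v t =
     - deriv u t - m / \<beta> * (\<sigma> * sin (half_sum \<beta> u v t) + 1 / \<sigma> * sin (half_diff \<beta> u v t))"

text \<open>Each condition is linear in a single momentum with coefficient of modulus 1, so the
  transformation is the graph of a map from the pair of fields to the pair of momenta.\<close>

lemma defect_conditions_iff:
  "defect_conditions m \<beta> \<sigma> u (\<lambda>t. - p t) v (\<lambda>t. - q t) \<longleftrightarrow>
     p = defect_p m \<beta> \<sigma> u v \<and> q = defect_q m \<beta> \<sigma> u v"
proof -
  have "- q t - deriv u t = m / \<beta> * (\<sigma> * sin (half_sum \<beta> u v t) + 1 / \<sigma> * sin (half_diff \<beta> u v t))
      \<longleftrightarrow> q t = defect_q m \<beta> \<sigma> u v t"
    "deriv v t - - p t = m / \<beta> * (\<sigma> * sin (half_sum \<beta> u v t) - 1 / \<sigma> * sin (half_diff \<beta> u v t))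
      \<longleftrightarrow> p t = defect_p m \<beta> \<sigma> u v t" for t
    unfolding defect_p_def defect_q_def by auto
  then show ?thesis
    unfolding defect_conditions_def fun_eq_iff half_sum_def half_diff_def by auto
qed

lemma schwartz_defect_momenta:
  assumes "\<beta> \<noteq> 0" and u: "field_boundary \<beta> Qm Qp u" and v: "field_boundary \<beta> Qtm Qtp v"
  shows "schwartz (defect_p m \<beta> \<sigma> u v)" and "schwartz (defect_q m \<beta> \<sigma> u v)"
  unfolding defect_p_def[abs_def] defect_q_def[abs_def]
  by (intro schwartz_add schwartz_diff schwartz_uminus schwartz_cmult schwartz_sin_half[OF assms]
      field_boundary_schwartz_deriv[OF u] field_boundary_schwartz_deriv[OF v])+

section \<open>The action and its first variation\<close>

lemma defect_B_half:
  "defect_B m \<beta> \<sigma> (u t) (v t) =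
     2 * m / \<beta>\<^sup>2 * (\<sigma> * cos (half_sum \<beta> u v t) + 1 / \<sigma> * cos (half_diff \<beta> u v t))"
  by (simp add: defect_B_def half_sum_def half_diff_def)

text \<open>The kinetic terms contain a Schwartz factor. The cosines tend to non-zero constants, but
  after subtraction of their vacuum values the Lipschitz bound makes them integrable.\<close>

lemma integrable_L_defect:
  assumes "\<beta> \<noteq> 0" and u: "field_boundary \<beta> Qm Qp u" and v: "field_boundary \<beta> Qtm Qtp v"
  shows "integrable lborel (\<lambda>t. L_defect m \<beta> \<sigma> u v t - L_vacuum m \<beta> \<sigma> Qm Qp Qtm Qtp t)"
proof -
  let ?u0 = "field_vacuum \<beta> Qm Qp" and ?v0 = "field_vacuum \<beta> Qtm Qtp"
  let ?e = "\<lambda>t. \<bar>\<beta>\<bar> / 2 * \<bar>\<bar>v t - ?v0 t\<bar> + \<bar>u t - ?u0 t\<bar>\<bar>"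
  have [measurable]: "u \<in> borel_measurable borel" "v \<in> borel_measurable borel"
    using u v by (auto intro: borel_measurable_isCont field_boundary_isCont)
  have e: "integrable lborel ?e"
    using field_boundary_integrable[OF u] field_boundary_integrable[OF v] by simp
  have c: "integrable lborel (\<lambda>t. cos (half_sum \<beta> u v t) - cos (half_sum \<beta> ?u0 ?v0 t))"
    "integrable lborel (\<lambda>t. cos (half_diff \<beta> u v t) - cos (half_diff \<beta> ?u0 ?v0 t))"
    using order_trans[OF abs_cos_diff_le half_field_diff_le(1)[of \<beta> u v _ ?u0 ?v0]]
      order_trans[OF abs_cos_diff_le half_field_diff_le(2)[of \<beta> u v _ ?u0 ?v0]]
    by (auto intro!: Bochner_Integration.integrable_bound[OF e] order_trans[OF _ abs_ge_self]
        simp: half_sum_def[abs_def] half_diff_def[abs_def])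
  have d: "integrable lborel (\<lambda>t. (deriv u t * v t - deriv v t * u t) / 2)"
    by (intro Bochner_Integration.integrable_divide Bochner_Integration.integrable_diff
        schwartz_integrable schwartz_mult_field[OF field_boundary_schwartz_deriv[OF u] v]
        schwartz_mult_field[OF field_boundary_schwartz_deriv[OF v] u])
  have "L_defect m \<beta> \<sigma> u v t - L_vacuum m \<beta> \<sigma> Qm Qp Qtm Qtp t =
      (deriv u t * v t - deriv v t * u t) / 2 - (2 * m / \<beta>\<^sup>2 *
        (\<sigma> * (cos (half_sum \<beta> u v t) - cos (half_sum \<beta> ?u0 ?v0 t)) +
         1 / \<sigma> * (cos (half_diff \<beta> u v t) - cos (half_diff \<beta> ?u0 ?v0 t))))" for t
    unfolding L_vacuum_eq L_defect_def defect_B_half by (simp add: algebra_simps)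
  then show ?thesis
    using c d by (auto simp del: times_divide_eq_left times_divide_eq_right
        intro!: Bochner_Integration.integrable_diff Bochner_Integration.integrable_add
          Bochner_Integration.integrable_mult_right)
qed

text \<open>The mean value theorem on [0, 1] along the segment from \<open>x\<close> to
  \<open>x + d\<close>, followed by the Lipschitz bound for the sine. The constant 1 in place of the
  sharp 1/2 is good enough for differentiability.\<close>

lemma cos_add_remainder: "\<bar>cos (x + d) - cos x + d * sin x\<bar> \<le> (d :: real)\<^sup>2"
proof -
  define g where "g s = cos (x + s * d) + s * d * sin x" for s
  have "\<exists>\<xi>. 0 < \<xi> \<and> \<xi> < 1 \<and> g 1 - g 0 = (1 - 0) * (- d * sin (x + \<xi> * d) + d * sin x)"
    unfolding g_def by (rule MVT2) (auto intro!: derivative_eq_intros)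
  then obtain \<xi> where \<xi>: "0 < \<xi>" "\<xi> < 1" and "g 1 - g 0 = (1 - 0) * (- d * sin (x + \<xi> * d) + d * sin x)"
    by blast
  then have "cos (x + d) - cos x + d * sin x = d * (sin x - sin (x + \<xi> * d))"
    by (simp add: g_def algebra_simps)
  then have "\<bar>cos (x + d) - cos x + d * sin x\<bar> = \<bar>d\<bar> * \<bar>sin x - sin (x + \<xi> * d)\<bar>"
    by (simp add: abs_mult)
  also have "\<dots> \<le> \<bar>d\<bar> * \<bar>d\<bar>"
  proof (intro mult_left_mono)
    have "\<bar>sin x - sin (x + \<xi> * d)\<bar> \<le> \<bar>\<xi>\<bar> * \<bar>d\<bar>"
      using abs_sin_diff_le[of x "x + \<xi> * d"] by (simp add: abs_mult)
    also have "\<dots> \<le> 1 * \<bar>d\<bar>" using \<xi> by (intro mult_right_mono) auto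
    finally show "\<bar>sin x - sin (x + \<xi> * d)\<bar> \<le> \<bar>d\<bar>" by simp
  qed simp
  finally show ?thesis by (simp add: power2_eq_square)
qed

text \<open>The remainder of the first-order Taylor expansion of \<open>defect_B\<close> at
  \<open>(a, b)\<close>. The coefficients of \<open>h\<close> and \<open>k\<close> are minus the
  partial derivatives, that is, the potential parts of \<open>defect_p\<close> and of
  \<open>- defect_q\<close>.\<close>

definition defect_B_remainder where
  "defect_B_remainder m \<beta> \<sigma> a b h k =
     defect_B m \<beta> \<sigma> (a + h) (b + k) - defect_B m \<beta> \<sigma> a b
       + m / \<beta> * (\<sigma> * sin (\<beta> * (b + a) / 2) - 1 / \<sigma> * sin (\<beta> * (b - a) / 2)) * h
       + m / \<beta> * (\<sigma> * sin (\<beta> * (b + a) / 2) + 1 / \<sigma> * sin (\<beta> * (b - a) / 2)) * k"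

text \<open>In the phases \<open>x\<close> and \<open>y\<close> the remainder splits into two
  independent cosine remainders with increments \<open>d\<close> and \<open>e\<close>. As
  \<open>d^2 + e^2 = \<beta>^2 / 2 * (h^2 + k^2)\<close>, the prefactor of the potential
  cancels.\<close>

lemma defect_B_remainder_le:
  assumes "\<beta> \<noteq> 0"
  shows "\<bar>defect_B_remainder m \<beta> \<sigma> a b h k\<bar> \<le> \<bar>m\<bar> * (\<bar>\<sigma>\<bar> + \<bar>1 / \<sigma>\<bar>) * (h * h + k * k)"
proof -
  define x y d e where "x = \<beta> * (b + a) / 2" and "y = \<beta> * (b - a) / 2"
    and "d = \<beta> * (k + h) / 2" and "e = \<beta> * (k - h) / 2"
  let ?r = "cos (x + d) - cos x + d * sin x" and ?s = "cos (y + e) - cos y + e * sin y"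
  have xy: "\<beta> * (b + k + (a + h)) / 2 = x + d" "\<beta> * (b + k - (a + h)) / 2 = y + e"
    by (simp_all add: x_def y_def d_def e_def field_simps)
  have de: "2 * m / \<beta>\<^sup>2 * d = m / \<beta> * (k + h)" "2 * m / \<beta>\<^sup>2 * e = m / \<beta> * (k - h)"
    using assms by (simp_all add: d_def e_def power2_eq_square field_simps)
  have "defect_B_remainder m \<beta> \<sigma> a b h k =
      2 * m / \<beta>\<^sup>2 * (\<sigma> * (cos (x + d) - cos x) + 1 / \<sigma> * (cos (y + e) - cos y))
      + \<sigma> * sin x * (m / \<beta> * (k + h)) + 1 / \<sigma> * sin y * (m / \<beta> * (k - h))"
    unfolding defect_B_remainder_def defect_B_def xy
    by (simp add: x_def y_def algebra_simps add_divide_distrib diff_divide_distrib)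
  also have "\<dots> = 2 * m / \<beta>\<^sup>2 * (\<sigma> * ?r + 1 / \<sigma> * ?s)"
    unfolding de[symmetric] by (simp add: algebra_simps)
  finally have eq: "\<bar>defect_B_remainder m \<beta> \<sigma> a b h k\<bar> = 2 * \<bar>m\<bar> / \<beta>\<^sup>2 * \<bar>\<sigma> * ?r + 1 / \<sigma> * ?s\<bar>"
    by (simp add: abs_mult)
  have "\<bar>\<sigma> * ?r + 1 / \<sigma> * ?s\<bar> \<le> \<bar>\<sigma>\<bar> * \<bar>?r\<bar> + \<bar>1 / \<sigma>\<bar> * \<bar>?s\<bar>"
    unfolding abs_mult[symmetric] by (rule abs_triangle_ineq)
  also have "\<dots> \<le> \<bar>\<sigma>\<bar> * (d\<^sup>2 + e\<^sup>2) + \<bar>1 / \<sigma>\<bar> * (d\<^sup>2 + e\<^sup>2)"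
    using cos_add_remainder[of x d] cos_add_remainder[of y e]
    by (intro add_mono mult_left_mono) (auto simp: add_increasing add_increasing2)
  also have "\<dots> = \<beta>\<^sup>2 / 2 * ((\<bar>\<sigma>\<bar> + \<bar>1 / \<sigma>\<bar>) * (h * h + k * k))"
  proof -
    have "d\<^sup>2 + e\<^sup>2 = \<beta>\<^sup>2 / 2 * (h * h + k * k)"
      by (simp add: d_def e_def power2_eq_square field_simps)
    then show ?thesis by (simp only: ring_distribs mult_ac)
  qed
  finally have "2 * \<bar>m\<bar> / \<beta>\<^sup>2 * \<bar>\<sigma> * ?r + 1 / \<sigma> * ?s\<bar>
      \<le> 2 * \<bar>m\<bar> / \<beta>\<^sup>2 * (\<beta>\<^sup>2 / 2 * ((\<bar>\<sigma>\<bar> + \<bar>1 / \<sigma>\<bar>) * (h * h + k * k)))"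
    by (rule mult_left_mono) simp
  also have "\<dots> = \<bar>m\<bar> * (\<bar>\<sigma>\<bar> + \<bar>1 / \<sigma>\<bar>) * (h * h + k * k)"
    using assms by simp
  finally show ?thesis unfolding eq .
qed

lemma DERIV_if_quadratic_remainder:
  fixes f :: "real \<Rightarrow> real"
  assumes "\<And>\<epsilon>. \<bar>f \<epsilon> - f 0 - \<epsilon> * D\<bar> \<le> K * \<epsilon>\<^sup>2"
  shows "(f has_real_derivative D) (at 0)"
  unfolding has_field_derivative_iff
proof (rule LIM_zero_cancel, rule Lim_null_comparison)
  have "\<bar>(f \<epsilon> - f 0) / \<epsilon> - D\<bar> \<le> K * \<bar>\<epsilon>\<bar>" if "\<epsilon> \<noteq> 0" for \<epsilon>
  proof -
    have "\<bar>(f \<epsilon> - f 0) / \<epsilon> - D\<bar> = \<bar>f \<epsilon> - f 0 - \<epsilon> * D\<bar> / \<bar>\<epsilon>\<bar>"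
      unfolding abs_divide[symmetric] using that by (simp add: field_simps)
    also have "\<dots> \<le> K * \<epsilon>\<^sup>2 / \<bar>\<epsilon>\<bar>" by (intro divide_right_mono assms) simp
    also have "\<dots> = K * \<bar>\<epsilon>\<bar>" using that by (simp add: power2_eq_square abs_if)
    finally show ?thesis .
  qed
  then show "\<forall>\<^sub>F \<epsilon> in at 0. norm ((f \<epsilon> - f 0) / (\<epsilon> - 0) - D) \<le> K * \<bar>\<epsilon>\<bar>"
    by (auto simp: eventually_at_filter)
  show "((\<lambda>\<epsilon>. K * \<bar>\<epsilon>\<bar>) \<longlongrightarrow> 0) (at (0::real))"
    by (auto intro!: tendsto_eq_intros)
qed

text \<open>Both fields are varied at once; the partial functional derivatives are the cases where
  one direction vanishes. The integrand is expanded exactly in \<epsilon>, with a remainder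
  dominated uniformly by \<open>\<epsilon>^2 * r\<close>, so nothing is differentiated under the
  integral.\<close>

lemma S_T_variation:
  fixes m \<sigma> :: real
  assumes b: "\<beta> \<noteq> 0" and u: "field_boundary \<beta> Qm Qp u" and v: "field_boundary \<beta> Qtm Qtp v"
    and h: "schwartz h" and k: "schwartz k"
  defines "p \<equiv> defect_p m \<beta> \<sigma> u v" and "q \<equiv> defect_q m \<beta> \<sigma> u v"
  shows "integrable lborel (\<lambda>t. p t * h t - q t * k t)"
    and "((\<lambda>\<epsilon>. S_T m \<beta> \<sigma> Qm Qp Qtm Qtp (\<lambda>t. u t + \<epsilon> * h t) (\<lambda>t. v t + \<epsilon> * k t))
            has_real_derivative (LBINT t. p t * h t - q t * k t)) (at 0)"
proof -
  have p: "schwartz p" and q: "schwartz q"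
    unfolding p_def q_def by (rule schwartz_defect_momenta[OF b u v])+
  have "schwartz (\<lambda>t. p t * h t - q t * k t)"
    by (intro schwartz_diff schwartz_mult_schwartz p q h k)
  then show int_pq: "integrable lborel (\<lambda>t. p t * h t - q t * k t)" by (rule schwartz_integrable)
  define R where "R \<epsilon> t = defect_B_remainder m \<beta> \<sigma> (u t) (v t) (\<epsilon> * h t) (\<epsilon> * k t)" for \<epsilon> t
  \<comment> \<open>\<open>w\<close> carries the integration by parts: the first-order kinetic term
    equals \<open>u' * k - v' * h\<close> plus half the derivative of \<open>w\<close>. The
    second-order kinetic term is \<open>z\<close>.\<close>
  define w where "w t = h t * v t - k t * u t" for t
  define z where "z t = (k t * deriv h t - h t * deriv k t) / 2" for t
  define r where "r t = h t * h t + k t * k t" for t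
  define C where "C = \<bar>m\<bar> * (\<bar>\<sigma>\<bar> + \<bar>1 / \<sigma>\<bar>)"
  define L0 where "L0 t = L_defect m \<beta> \<sigma> u v t - L_vacuum m \<beta> \<sigma> Qm Qp Qtm Qtp t" for t
  have w: "schwartz w"
    unfolding w_def by (intro schwartz_diff schwartz_mult_field[OF h v] schwartz_mult_field[OF k u])
  have dw: "deriv w t = (deriv h t * v t + deriv v t * h t) - (deriv k t * u t + deriv u t * k t)" for t
    unfolding w_def
    by (intro DERIV_imp_deriv DERIV_diff DERIV_mult schwartz_DERIV h k
        field_boundary_DERIV[OF u] field_boundary_DERIV[OF v])
  have int_z: "integrable lborel z"
    unfolding z_def by (intro Bochner_Integration.integrable_divide schwartz_integrable
        schwartz_diff schwartz_mult_schwartz h k schwartz_deriv)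
  have int_r: "integrable lborel r"
    unfolding r_def by (intro schwartz_integrable schwartz_add schwartz_mult_schwartz h k)
  have int_0: "integrable lborel L0"
    unfolding L0_def by (rule integrable_L_defect[OF b u v])
  have int_w: "integrable lborel (deriv w)"
    by (rule schwartz_integrable[OF schwartz_deriv[OF w]])
  have R_le: "\<bar>R \<epsilon> t\<bar> \<le> C * \<epsilon>\<^sup>2 * r t" for \<epsilon> t
    using defect_B_remainder_le[OF b, of m \<sigma> "u t" "v t" "\<epsilon> * h t" "\<epsilon> * k t"]
    by (simp add: R_def C_def r_def power2_eq_square algebra_simps)
  have [measurable]: "u \<in> borel_measurable borel" "v \<in> borel_measurable borel"
      "h \<in> borel_measurable borel" "k \<in> borel_measurable borel"
    using u v h k by (auto intro: borel_measurable_isCont field_boundary_isCont schwartz_isCont)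
  have int_R: "integrable lborel (R \<epsilon>)" for \<epsilon>
  proof (rule Bochner_Integration.integrable_bound)
    show "integrable lborel (\<lambda>t. C * \<epsilon>\<^sup>2 * r t)" using int_r by simp
    show "R \<epsilon> \<in> borel_measurable lborel"
      unfolding R_def[abs_def] defect_B_remainder_def defect_B_def by measurable
    show "AE t in lborel. norm (R \<epsilon> t) \<le> norm (C * \<epsilon>\<^sup>2 * r t)"
      using order_trans[OF R_le abs_ge_self] by simp
  qed
  have expand: "L_defect m \<beta> \<sigma> (\<lambda>t. u t + \<epsilon> * h t) (\<lambda>t. v t + \<epsilon> * k t) t
        - L_vacuum m \<beta> \<sigma> Qm Qp Qtm Qtp t
      = L0 t + \<epsilon> * ((p t * h t - q t * k t) + deriv w t / 2) + (\<epsilon>\<^sup>2 * z t - R \<epsilon> t)" for \<epsilon> t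
  proof -
    have du: "deriv (\<lambda>t. u t + \<epsilon> * h t) t = deriv u t + \<epsilon> * deriv h t"
      "deriv (\<lambda>t. v t + \<epsilon> * k t) t = deriv v t + \<epsilon> * deriv k t"
      by (intro DERIV_imp_deriv DERIV_add DERIV_cmult schwartz_DERIV h k
        field_boundary_DERIV[OF u] field_boundary_DERIV[OF v])+
    show ?thesis
      unfolding L_defect_def du L0_def R_def defect_B_remainder_def z_def dw p_def q_def
        defect_p_def defect_q_def half_sum_def half_diff_def
      by (simp add: power2_eq_square algebra_simps add_divide_distrib diff_divide_distrib)
  qed
  have S: "S_T m \<beta> \<sigma> Qm Qp Qtm Qtp (\<lambda>t. u t + \<epsilon> * h t) (\<lambda>t. v t + \<epsilon> * k t)
      = integral\<^sup>L lborel L0 + \<epsilon> * (LBINT t. p t * h t - q t * k t)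
        + (\<epsilon>\<^sup>2 * integral\<^sup>L lborel z - integral\<^sup>L lborel (R \<epsilon>))" for \<epsilon>
    unfolding S_T_def expand
    using int_0 int_pq int_w int_z int_R[of \<epsilon>] integral_deriv_schwartz[OF w]
    by (simp add: Bochner_Integration.integral_add Bochner_Integration.integral_diff)
  have IR: "\<bar>integral\<^sup>L lborel (R \<epsilon>)\<bar> \<le> C * \<epsilon>\<^sup>2 * integral\<^sup>L lborel r" for \<epsilon>
  proof -
    have "\<bar>integral\<^sup>L lborel (R \<epsilon>)\<bar> \<le> (LBINT t. \<bar>R \<epsilon> t\<bar>)"
      using integral_norm_bound[of lborel "R \<epsilon>"] by simp
    also have "\<dots> \<le> (LBINT t. C * \<epsilon>\<^sup>2 * r t)"
      by (intro integral_mono R_le) (use int_R int_r in auto)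
    finally show ?thesis by simp
  qed
  show "((\<lambda>\<epsilon>. S_T m \<beta> \<sigma> Qm Qp Qtm Qtp (\<lambda>t. u t + \<epsilon> * h t) (\<lambda>t. v t + \<epsilon> * k t))
            has_real_derivative (LBINT t. p t * h t - q t * k t)) (at 0)"
  proof (rule DERIV_if_quadratic_remainder)
    fix \<epsilon> :: real
    \<comment> \<open>The term with \<open>R 0\<close> comes from the action at \<epsilon> = 0; the
      bound \<open>IR\<close> makes its integral vanish.\<close>
    have "\<bar>\<epsilon>\<^sup>2 * integral\<^sup>L lborel z - integral\<^sup>L lborel (R \<epsilon>) + integral\<^sup>L lborel (R 0)\<bar>
        \<le> (\<bar>integral\<^sup>L lborel z\<bar> + C * integral\<^sup>L lborel r) * \<epsilon>\<^sup>2"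
      using IR[of \<epsilon>] IR[of 0] abs_triangle_ineq4[of "\<epsilon>\<^sup>2 * integral\<^sup>L lborel z" "integral\<^sup>L lborel (R \<epsilon>)"]
      by (simp add: abs_mult algebra_simps)
    then show "\<bar>S_T m \<beta> \<sigma> Qm Qp Qtm Qtp (\<lambda>t. u t + \<epsilon> * h t) (\<lambda>t. v t + \<epsilon> * k t)
        - S_T m \<beta> \<sigma> Qm Qp Qtm Qtp (\<lambda>t. u t + 0 * h t) (\<lambda>t. v t + 0 * k t)
        - \<epsilon> * (LBINT t. p t * h t - q t * k t)\<bar>
        \<le> (\<bar>integral\<^sup>L lborel z\<bar> + C * integral\<^sup>L lborel r) * \<epsilon>\<^sup>2"
      unfolding S by (simp add: algebra_simps)
  qed
qed

section \<open>Uniqueness of functional derivatives\<close>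

text \<open>The zero set is closed and of full measure, hence it is the whole line.\<close>

lemma isCont_AE_eq_0:
  fixes f :: "real \<Rightarrow> real"
  assumes cont: "\<And>t. isCont f t" and ae: "AE t in lborel. f t = 0"
  shows "f t = 0"
proof -
  have "closed {t. f t = 0}"
    by (rule closed_Collect_eq) (auto intro: continuous_at_imp_continuous_on cont)
  moreover have "AE t in lebesgue. t \<in> {t. f t = 0}"
    using AE_completion[OF ae] by simp
  ultimately show ?thesis using mem_closed_if_AE_lebesgue by blast
qed

text \<open>Only Schwartz functions are compared, so their difference is itself an admissible variation.\<close>

lemma has_functional_derivative_unique:
  assumes f: "has_functional_derivative F u f" and g: "has_functional_derivative F u g"
    and sf: "schwartz f" and sg: "schwartz g"
  shows "f = g"
proof
  fix t
  define h where "h s = f s - g s" for s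
  have h: "schwartz h" unfolding h_def by (intro schwartz_diff sf sg)
  have "(LBINT s. f s * h s) = (LBINT s. g s * h s)"
    using f g h unfolding has_functional_derivative_def by (meson DERIV_unique)
  moreover have "integrable lborel (\<lambda>s. f s * h s)" "integrable lborel (\<lambda>s. g s * h s)"
    using f g h unfolding has_functional_derivative_def by auto
  ultimately have "(LBINT s. h s * h s) = 0"
    by (simp add: h_def left_diff_distrib)
  then have "AE s in lborel. h s * h s = 0"
    using integral_nonneg_eq_0_iff_AE[OF schwartz_integrable[OF schwartz_mult_schwartz[OF h h]]] by simp
  then have "h t * h t = 0"
    by (intro isCont_AE_eq_0[of "\<lambda>s. h s * h s"]) (auto intro: isCont_mult schwartz_isCont[OF h])
  then show "f t = g t" by (simp add: h_def)
qed

lemma S_T_functional_derivatives: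
  assumes "\<beta> \<noteq> 0" and u: "field_boundary \<beta> Qm Qp u" and v: "field_boundary \<beta> Qtm Qtp v"
  shows "has_functional_derivative (\<lambda>u. S_T m \<beta> \<sigma> Qm Qp Qtm Qtp u v) u (defect_p m \<beta> \<sigma> u v)"
    and "has_functional_derivative (\<lambda>v. S_T m \<beta> \<sigma> Qm Qp Qtm Qtp u v) v (\<lambda>t. - defect_q m \<beta> \<sigma> u v t)"
  using S_T_variation[OF assms _ schwartz_0] S_T_variation[OF assms schwartz_0]
  by (simp_all add: has_functional_derivative_def)

text \<open>Both sides amount to \<open>p\<close> and \<open>q\<close> being the momenta solved from
  the conditions: the left by linearity in the momenta, the right by uniqueness among Schwartz
  functional derivatives.\<close>

lemma defect_conditions_iff_functional_derivatives:
  assumes "\<beta> \<noteq> 0" and u: "field_boundary \<beta> Qm Qp u" and v: "field_boundary \<beta> Qtm Qtp v"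
    and p: "schwartz p" and q: "schwartz q"
  shows "defect_conditions m \<beta> \<sigma> u (\<lambda>t. - p t) v (\<lambda>t. - q t) \<longleftrightarrow>
    has_functional_derivative (\<lambda>u. S_T m \<beta> \<sigma> Qm Qp Qtm Qtp u v) u p \<and>
    has_functional_derivative (\<lambda>v. S_T m \<beta> \<sigma> Qm Qp Qtm Qtp u v) v (\<lambda>t. - q t)"
    (is "_ \<longleftrightarrow> ?P \<and> ?Q")
proof -
  note D = S_T_functional_derivatives[OF assms(1-3), of m \<sigma>]
  note s = schwartz_defect_momenta[OF assms(1-3), of m \<sigma>]
  have "?P \<longleftrightarrow> p = defect_p m \<beta> \<sigma> u v"
    using has_functional_derivative_unique[OF _ D(1) p s(1)] D(1) by blast
  moreover have "?Q \<longleftrightarrow> q = defect_q m \<beta> \<sigma> u v"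
    using has_functional_derivative_unique[OF _ D(2) schwartz_uminus[OF q] schwartz_uminus[OF s(2)]] D(2)
    by (auto simp: fun_eq_iff)
  ultimately show ?thesis by (simp add: defect_conditions_iff)
qed

lemma generating_functional_S_T:
  assumes "\<beta> \<noteq> 0"
  shows "generating_functional \<beta> Qm Qp Qtm Qtp (defect_transformation m \<beta> \<sigma>)
    (S_T m \<beta> \<sigma> Qm Qp Qtm Qtp)"
  unfolding generating_functional_def defect_transformation_def phase_space_def
  using S_T_variation[OF assms] by (auto simp: defect_conditions_iff)

lemma defect_momenta_ex1:
  assumes "\<beta> \<noteq> 0" and "field_boundary \<beta> Qm Qp u" and "field_boundary \<beta> Qtm Qtp v"
  shows "\<exists>!(p, q). schwartz p \<and> schwartz q \<and> defect_transformation m \<beta> \<sigma> (u, p) (v, q)"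
  using schwartz_defect_momenta[OF assms, of m \<sigma>]
  by (auto simp: defect_transformation_def defect_conditions_iff)


section \<open>The gauge transformation of the defect\<close>

text \<open>Explicit entries turn every matrix identity below into four scalar ones.\<close>

definition mat2 :: "complex \<Rightarrow> complex \<Rightarrow> complex \<Rightarrow> complex \<Rightarrow> complex^2^2" where
  "mat2 a b c d = vector [vector [a, b], vector [c, d]]"

lemma mat2_nth [simp]:
  "mat2 a b c d $ 1 $ 1 = a" "mat2 a b c d $ 1 $ 2 = b"
  "mat2 a b c d $ 2 $ 1 = c" "mat2 a b c d $ 2 $ 2 = d"
  by (simp_all add: mat2_def)

lemma mat2_eqI:
  "A $ 1 $ 1 = B $ 1 $ 1 \<Longrightarrow> A $ 1 $ 2 = B $ 1 $ 2 \<Longrightarrow> A $ 2 $ 1 = B $ 2 $ 1 \<Longrightarrow> A $ 2 $ 2 = B $ 2 $ 2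
    \<Longrightarrow> A = B" for A B :: "complex^2^2"
  by (simp add: vec_eq_iff forall_2)

lemma mat2_eq_iff [simp]: "mat2 a b c d = mat2 a' b' c' d' \<longleftrightarrow> a = a' \<and> b = b' \<and> c = c' \<and> d = d'"
  by (metis mat2_nth)

lemma mult_nth2: "(A ** B) $ i $ j = A $ i $ 1 * B $ 1 $ j + A $ i $ 2 * B $ 2 $ j"
  for A B :: "complex^2^2"
  by (simp add: matrix_matrix_mult_def sum_2)

lemma mat2_mult: "mat2 a b c d ** mat2 a' b' c' d' =
    mat2 (a * a' + b * c') (a * b' + b * d') (c * a' + d * c') (c * b' + d * d')"
  by (rule mat2_eqI) (simp_all add: mult_nth2)

lemma mat2_add: "mat2 a b c d + mat2 a' b' c' d' = mat2 (a + a') (b + b') (c + c') (d + d')"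
  and mat2_diff: "mat2 a b c d - mat2 a' b' c' d' = mat2 (a - a') (b - b') (c - c') (d - d')"
  and mat2_cscale: "z \<odot> mat2 a b c d = mat2 (z * a) (z * b) (z * c) (z * d)"
  and mat2_one: "(mat 1 :: complex^2^2) = mat2 1 0 0 1"
  by (rule mat2_eqI; simp add: cscale_def mat_def)+

lemma mat2_has_vector_derivative:
  assumes "(a has_vector_derivative a') (at t)" "(b has_vector_derivative b') (at t)"
    "(c has_vector_derivative c') (at t)" "(d has_vector_derivative d') (at t)"
  shows "((\<lambda>t. mat2 (a t) (b t) (c t) (d t)) has_vector_derivative mat2 a' b' c' d') (at t)"
proof -
  have "linear (\<lambda>z. mat2 z 0 0 0)" "linear (\<lambda>z. mat2 0 z 0 0)"
    "linear (\<lambda>z. mat2 0 0 z 0)" "linear (\<lambda>z. mat2 0 0 0 z)"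
    by (rule linearI; rule mat2_eqI; simp)+
  then have bl: "bounded_linear (\<lambda>z. mat2 z 0 0 0)" "bounded_linear (\<lambda>z. mat2 0 z 0 0)"
    "bounded_linear (\<lambda>z. mat2 0 0 z 0)" "bounded_linear (\<lambda>z. mat2 0 0 0 z)"
    by (simp_all add: linear_conv_bounded_linear)
  note D = bounded_linear.has_vector_derivative[OF bl(1) assms(1)]
    bounded_linear.has_vector_derivative[OF bl(2) assms(2)]
    bounded_linear.has_vector_derivative[OF bl(3) assms(3)]
    bounded_linear.has_vector_derivative[OF bl(4) assms(4)]
  show ?thesis
    using has_vector_derivative_add[OF has_vector_derivative_add[OF D(1,2)]
        has_vector_derivative_add[OF D(3,4)]] by (simp add: mat2_add)
qed

lemma mat2_tendsto:
  assumes "(a \<longlongrightarrow> a') F" "(b \<longlongrightarrow> b') F" "(c \<longlongrightarrow> c') F" "(d \<longlongrightarrow> d') F"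
  shows "((\<lambda>t. mat2 (a t) (b t) (c t) (d t)) \<longlongrightarrow> mat2 a' b' c' d') F"
proof (intro vec_tendstoI)
  fix i j :: 2
  show "((\<lambda>t. mat2 (a t) (b t) (c t) (d t) $ i $ j) \<longlongrightarrow> mat2 a' b' c' d' $ i $ j) F"
    using assms exhaust_2[of i] exhaust_2[of j] by auto
qed

lemma bounded_bilinear_matrix_mult:
  "bounded_bilinear ((**) :: complex^2^2 \<Rightarrow> complex^2^2 \<Rightarrow> complex^2^2)"
  unfolding bilinear_conv_bounded_bilinear[symmetric] bilinear_def
  by (auto intro!: linearI mat2_eqI simp: mult_nth2 algebra_simps)

lemmas tendsto_matrix_mult = bounded_bilinear.tendsto[OF bounded_bilinear_matrix_mult]

text \<open>The adjugate. For matrices of size two it is linear in \<open>A\<close>, so it can be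
  differentiated, and \<open>adj2 A ** A\<close> is the determinant times the identity.\<close>

definition adj2 :: "complex^2^2 \<Rightarrow> complex^2^2" where
  "adj2 A = mat2 (A $ 2 $ 2) (- A $ 1 $ 2) (- A $ 2 $ 1) (A $ 1 $ 1)"

lemma bounded_linear_adj2: "bounded_linear adj2"
  unfolding linear_conv_bounded_linear[symmetric]
  by (auto intro!: linearI mat2_eqI simp: adj2_def)

lemma adj2_mult: "adj2 (A ** B) = adj2 B ** adj2 A"
  by (rule mat2_eqI) (simp_all add: adj2_def mult_nth2)

text \<open>For a traceless generator \<open>adj2 X ** Y\<close> is a Wronskian: it is constant in time.\<close>

lemma adj2_mult_solutions_const:
  fixes V X Y :: "real \<Rightarrow> complex^2^2"
  assumes tr: "\<And>t. V t $ 1 $ 1 + V t $ 2 $ 2 = 0"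
    and X: "\<And>t. (X has_vector_derivative V t ** X t) (at t)"
    and Y: "\<And>t. (Y has_vector_derivative V t ** Y t) (at t)"
  shows "adj2 (X s) ** Y s = adj2 (X t) ** Y t"
proof -
  have "((\<lambda>t. adj2 (X t) ** Y t) has_vector_derivative 0) (at t)" for t
  proof -
    have "V t $ 2 $ 2 = - V t $ 1 $ 1" using tr[of t] by (simp add: eq_neg_iff_add_eq_0 add.commute)
    \<comment> \<open>For a traceless generator the adjugate is the negative, so the two terms of
      the product rule cancel.\<close>
    then have aV: "adj2 (V t) = - V t" by (auto intro!: mat2_eqI simp: adj2_def)
    have "adj2 (X t) ** (V t ** Y t) + adj2 (V t ** X t) ** Y t = 0"
      unfolding adj2_mult aV by (intro mat2_eqI) (simp_all add: mult_nth2 algebra_simps)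
    moreover have "((\<lambda>t. adj2 (X t) ** Y t) has_vector_derivative
        adj2 (X t) ** (V t ** Y t) + adj2 (V t ** X t) ** Y t) (at t)"
      by (intro bounded_bilinear.has_vector_derivative[OF bounded_bilinear_matrix_mult]
          bounded_linear.has_vector_derivative[OF bounded_linear_adj2] X Y)
    ultimately show ?thesis by simp
  qed
  then obtain c where "\<And>t. adj2 (X t) ** Y t = c"
    using has_vector_derivative_zero_constant[of UNIV "\<lambda>t. adj2 (X t) ** Y t"] by auto
  then show ?thesis by simp
qed

text \<open>\<open>adj2 S ** S\<close> and \<open>adj2 S ** T\<close> are constant in time and equal
  1 at \<open>t = \<tau>\<close>. The first makes \<open>adj2 S\<close> the inverse of
  \<open>S\<close>, and then the second gives \<open>S = T\<close>.\<close>

lemma transition_matrix_unique: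
  assumes tr: "\<And>t. V t $ 1 $ 1 + V t $ 2 $ 2 = 0"
    and S: "transition_matrix V S" and T: "transition_matrix V T"
  shows "S = T"
proof (intro ext)
  fix t \<tau>
  note D = S[unfolded transition_matrix_def] T[unfolded transition_matrix_def]
  have adj1: "adj2 (mat 1) = mat 1" by (simp add: adj2_def mat2_one)
  have "adj2 (S t \<tau>) ** S t \<tau> = adj2 (S \<tau> \<tau>) ** S \<tau> \<tau>"
    using D by (intro adj2_mult_solutions_const[where X = "\<lambda>t. S t \<tau>" and Y = "\<lambda>t. S t \<tau>", OF tr]) auto
  then have "adj2 (S t \<tau>) ** S t \<tau> = mat 1" using D adj1 by simp
  then have inv: "S t \<tau> ** adj2 (S t \<tau>) = mat 1" by (simp add: matrix_left_right_inverse)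
  have "adj2 (S t \<tau>) ** T t \<tau> = adj2 (S \<tau> \<tau>) ** T \<tau> \<tau>"
    using D by (intro adj2_mult_solutions_const[where X = "\<lambda>t. S t \<tau>" and Y = "\<lambda>t. T t \<tau>", OF tr]) auto
  then have "adj2 (S t \<tau>) ** T t \<tau> = mat 1" using D adj1 by simp
  then have "S t \<tau> = (S t \<tau> ** adj2 (S t \<tau>)) ** T t \<tau>" by (simp add: matrix_mul_assoc[symmetric])
  then show "S t \<tau> = T t \<tau>" by (simp add: inv)
qed

text \<open>The hypothesis on \<open>G\<close> is the gauge relation
  \<open>W = G' G^{-1} + G V G^{-1}\<close>, multiplied by \<open>G\<close> to avoid the
  inverse.\<close>

lemma transition_matrix_gauge:
  assumes T: "transition_matrix V T"
    and G: "\<And>t. (G has_vector_derivative W t ** G t - G t ** V t) (at t)"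
    and inv: "\<And>t. G t ** H t = mat 1"
  shows "transition_matrix W (\<lambda>t \<tau>. G t ** T t \<tau> ** H \<tau>)"
  unfolding transition_matrix_def
proof (intro conjI allI)
  note bb = bounded_bilinear_matrix_mult
  fix \<tau> t
  have "((\<lambda>s. T s \<tau>) has_vector_derivative V t ** T t \<tau>) (at t)"
    using T by (simp add: transition_matrix_def)
  note D = bounded_bilinear.has_vector_derivative[OF bb
      bounded_bilinear.has_vector_derivative[OF bb G this] has_vector_derivative_const[of "H \<tau>"]]
  have "G t ** T t \<tau> ** 0 + (G t ** (V t ** T t \<tau>) + (W t ** G t - G t ** V t) ** T t \<tau>) ** H \<tau>
      = W t ** (G t ** T t \<tau> ** H \<tau>)"
    by (rule mat2_eqI; simp add: mult_nth2 algebra_simps)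
  then show "((\<lambda>s. G s ** T s \<tau> ** H \<tau>) has_vector_derivative W t ** (G t ** T t \<tau> ** H \<tau>)) (at t)"
    using D by simp
next
  fix \<tau> show "G \<tau> ** T \<tau> \<tau> ** H \<tau> = mat 1"
    using T inv by (simp add: transition_matrix_def)
qed

section \<open>Vacuum frames and the Lax matrix in exponential form\<close>

lemma exp_pauli3_mat2: "exp_pauli3 z = mat2 (exp z) 0 0 (exp (- z))"
  by (simp add: exp_pauli3_def mat2_def)

lemma N_mat_mat2: "N_mat = mat2 (of_real (1 / sqrt 2)) (\<i> * of_real (1 / sqrt 2))
    (\<i> * of_real (1 / sqrt 2)) (of_real (1 / sqrt 2))"
  unfolding N_mat_def pauli1_def mat2_def[symmetric] mat2_one mat2_cscale mat2_add by simp

definition N_inv :: "complex^2^2" where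
  "N_inv = mat2 (of_real (1 / sqrt 2)) (- \<i> * of_real (1 / sqrt 2))
    (- \<i> * of_real (1 / sqrt 2)) (of_real (1 / sqrt 2))"

lemma half_sqrt2: "complex_of_real (1 / sqrt 2) * of_real (1 / sqrt 2) = 1 / 2"
  unfolding of_real_mult[symmetric] by (simp add: real_sqrt_mult_self)

lemma N_mat_inv: "N_mat ** N_inv = mat 1" "N_inv ** N_mat = mat 1"
  unfolding N_mat_mat2 N_inv_def mat2_mult mat2_one mat2_eq_iff
  using half_sqrt2 by (simp_all add: algebra_simps)

lemma exp_pauli3_inv: "exp_pauli3 z ** exp_pauli3 (- z) = mat 1"
  by (simp add: exp_pauli3_mat2 mat2_mult mat2_one exp_minus)

definition E_inv :: "real \<Rightarrow> int \<Rightarrow> real \<Rightarrow> real \<Rightarrow> complex^2^2" where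
  "E_inv m Q l t =
     exp_pauli3 (\<i> * of_real (k0 m l * t)) ** N_inv ** exp_pauli3 (- \<i> * of_real (pi / 2 * of_int Q))"

lemma E_mat_inv: "E_mat m Q l t ** E_inv m Q l t = mat 1" "E_inv m Q l t ** E_mat m Q l t = mat 1"
proof -
  let ?P = "exp_pauli3 (\<i> * of_real (pi / 2 * of_int Q))"
  let ?P' = "exp_pauli3 (- (\<i> * of_real (pi / 2 * of_int Q)))"
  let ?X = "exp_pauli3 (- (\<i> * of_real (k0 m l * t)))" and ?X' = "exp_pauli3 (\<i> * of_real (k0 m l * t))"
  have "?X ** ?X' = mat 1" using exp_pauli3_inv[of "- (\<i> * of_real (k0 m l * t))"] by simp
  then have "?P ** N_mat ** (?X ** ?X') ** N_inv ** ?P' = mat 1"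
    using N_mat_inv exp_pauli3_inv by (simp add: matrix_mul_assoc[symmetric])
  then show "E_mat m Q l t ** E_inv m Q l t = mat 1"
    by (simp add: E_mat_def E_inv_def matrix_mul_assoc)
  then show "E_inv m Q l t ** E_mat m Q l t = mat 1" by (simp add: matrix_left_right_inverse)
qed

lemma matrix_inv_E_mat: "matrix_inv (E_mat m Q l t) = E_inv m Q l t"
proof -
  have "matrix_inv (E_mat m Q l t) ** E_mat m Q l t = mat 1"
    unfolding matrix_inv_def by (rule someI2[of _ "E_inv m Q l t"]) (simp_all add: E_mat_inv)
  then have "matrix_inv (E_mat m Q l t) ** E_mat m Q l t ** E_inv m Q l t = E_inv m Q l t"
    by simp
  then show ?thesis by (simp add: matrix_mul_assoc[symmetric] E_mat_inv)
qed

text \<open>Off the diagonal, the \<open>k1\<close> sine and \<open>k0\<close> cosine terms combine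
  into exponentials of the angle weighted by \<open>l\<close> and \<open>1 / l\<close>. This makes
  the entries rational in the variables of \<open>zero_curvature_algebra\<close>.\<close>

lemma lax_V_mat2:
  "lax_V m \<beta> u p l t =
    mat2 (\<i> * of_real (\<beta> / 4 * p t))
      (- of_real (m / 4) * (of_real l * cis (\<beta> * u t / 2) + cis (- (\<beta> * u t / 2)) / of_real l))
      (of_real (m / 4) * (of_real l * cis (- (\<beta> * u t / 2)) + cis (\<beta> * u t / 2) / of_real l))
      (- \<i> * of_real (\<beta> / 4 * p t))"
  unfolding lax_V_def pauli1_def pauli2_def pauli3_def mat2_def[symmetric] mat2_cscale mat2_diff mat2_eq_iff
  by (simp_all add: complex_eq_iff k0_def k1_def field_simps)

text \<open>The determinant is \<open>l^2 + \<sigma>^2\<close>, independent of the fields, so the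
  matrix is invertible at all times for real \<open>l \<noteq> 0\<close>.\<close>

definition defect_K ::
    "real \<Rightarrow> real \<Rightarrow> (real \<Rightarrow> real) \<Rightarrow> (real \<Rightarrow> real) \<Rightarrow> real \<Rightarrow> real \<Rightarrow> complex^2^2" where
  "defect_K \<beta> \<sigma> u v l t =
     mat2 (of_real l * cis (half_diff \<beta> u v t / 2)) (of_real \<sigma> * cis (- (half_sum \<beta> u v t / 2)))
       (- of_real \<sigma> * cis (half_sum \<beta> u v t / 2)) (of_real l * cis (- (half_diff \<beta> u v t / 2)))"

lemma cis_has_vector_derivative:
  assumes "(w has_real_derivative w') (at t)"
  shows "((\<lambda>t. cis (w t)) has_vector_derivative \<i> * of_real w' * cis (w t)) (at t)"
proof -
  have "((\<lambda>t. exp (\<i> * of_real (w t))) has_vector_derivative \<i> * of_real w' * exp (\<i> * of_real (w t))) (at t)"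
  proof -
    have "((\<lambda>t. \<i> * complex_of_real (w t)) has_vector_derivative \<i> * of_real w') (at t)"
      using assms by (auto intro!: derivative_eq_intros simp: has_real_derivative_iff_has_vector_derivative)
    from field_vector_diff_chain_at[OF this, of exp "exp (\<i> * of_real (w t))"]
    show ?thesis by (simp add: o_def DERIV_exp)
  qed
  then show ?thesis by (simp add: cis_conv_exp)
qed

text \<open>Below, a multiple of \<open>H\<close> or \<open>D\<close> is added to each entry: it vanishes, and with it the entry
  becomes an identity of rational functions in independent variables.\<close>

lemma zero_curvature_algebra:
  fixes A B l m b s U W SH SD :: complex
  assumes nz: "A \<noteq> 0" "B \<noteq> 0" "l \<noteq> 0" "b \<noteq> 0" "s \<noteq> 0"
    and H: "A * A - 1 / (A * A) = 2 * \<i> * SH" and D: "B * B - 1 / (B * B) = 2 * \<i> * SD"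
  defines "P \<equiv> - W + m / b * (s * SH - 1 / s * SD)"
    and "Q \<equiv> - U - m / b * (s * SH + 1 / s * SD)"
  defines "K \<equiv> mat2 (l * B) (s * (1 / A)) (- s * A) (l * (1 / B))"
    and "Vu \<equiv> mat2 (\<i> * (b / 4 * P)) (- (m / 4) * (l * (A / B) + B / A / l))
           (m / 4 * (l * (B / A) + A / B / l)) (- \<i> * (b / 4 * P))"
    and "Vv \<equiv> mat2 (\<i> * (b / 4 * Q)) (- (m / 4) * (l * (A * B) + 1 / (A * B) / l))
           (m / 4 * (l * (1 / (A * B)) + A * B / l)) (- \<i> * (b / 4 * Q))"
  shows "mat2 (l * (\<i> * (b / 4 * (W - U)) * B)) (s * (\<i> * - (b / 4 * (W + U)) * (1 / A)))
      (- s * (\<i> * (b / 4 * (W + U)) * A)) (l * (\<i> * - (b / 4 * (W - U)) * (1 / B)))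
    = Vv ** K - K ** Vu"
  \<comment> \<open>\<open>A\<close> and \<open>B\<close> stand for the exponentials of half of
    \<open>half_sum\<close> and \<open>half_diff\<close>, \<open>SH\<close> and \<open>SD\<close>
    for the sines, \<open>W\<close> and \<open>U\<close> for the time derivatives of
    \<open>v\<close> and \<open>u\<close>. Diagonal entries contain \<open>Q - P\<close>, where
    \<open>SD\<close> cancels, and use \<open>H\<close>; off-diagonal ones contain
    \<open>Q + P\<close>, where \<open>SH\<close> cancels, and use \<open>D\<close>.\<close>
  unfolding K_def Vu_def Vv_def mat2_mult mat2_diff mat2_eq_iff
proof (intro conjI)
  have "l * (\<i> * (b / 4 * (W - U)) * B) =
      (\<i> * (b / 4 * Q)) * (l * B) + (- (m / 4) * (l * (A * B) + 1 / (A * B) / l)) * (- s * A) - ((l * B) * (\<i> * (b / 4 * P)) + (s * (1 / A)) * (m / 4 * (l * (B / A) + A / B / l)))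
      + - (m / 4 * s * l * B) * (A * A - 1 / (A * A) - 2 * \<i> * SH)"
    unfolding P_def Q_def using nz by (simp add: divide_simps) algebra
  then show "l * (\<i> * (b / 4 * (W - U)) * B) =
      (\<i> * (b / 4 * Q)) * (l * B) + (- (m / 4) * (l * (A * B) + 1 / (A * B) / l)) * (- s * A) - ((l * B) * (\<i> * (b / 4 * P)) + (s * (1 / A)) * (m / 4 * (l * (B / A) + A / B / l)))"
    unfolding H by (simp only: diff_self mult_zero_right add_0_right)
next
  have "s * (\<i> * - (b / 4 * (W + U)) * (1 / A)) =
      (\<i> * (b / 4 * Q)) * (s * (1 / A)) + (- (m / 4) * (l * (A * B) + 1 / (A * B) / l)) * (l * (1 / B)) - ((l * B) * (- (m / 4) * (l * (A / B) + B / A / l)) + (s * (1 / A)) * (- \<i> * (b / 4 * P)))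
      + - (m / (4 * A)) * (B * B - 1 / (B * B) - 2 * \<i> * SD)"
    unfolding P_def Q_def using nz by (simp add: divide_simps) algebra
  then show "s * (\<i> * - (b / 4 * (W + U)) * (1 / A)) =
      (\<i> * (b / 4 * Q)) * (s * (1 / A)) + (- (m / 4) * (l * (A * B) + 1 / (A * B) / l)) * (l * (1 / B)) - ((l * B) * (- (m / 4) * (l * (A / B) + B / A / l)) + (s * (1 / A)) * (- \<i> * (b / 4 * P)))"
    unfolding D by (simp only: diff_self mult_zero_right add_0_right)
next
  have "- s * (\<i> * (b / 4 * (W + U)) * A) =
      (m / 4 * (l * (1 / (A * B)) + A * B / l)) * (l * B) + (- \<i> * (b / 4 * Q)) * (- s * A) - ((- s * A) * (\<i> * (b / 4 * P)) + (l * (1 / B)) * (m / 4 * (l * (B / A) + A / B / l)))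
      + - (m / 4 * A) * (B * B - 1 / (B * B) - 2 * \<i> * SD)"
    unfolding P_def Q_def using nz by (simp add: divide_simps) algebra
  then show "- s * (\<i> * (b / 4 * (W + U)) * A) =
      (m / 4 * (l * (1 / (A * B)) + A * B / l)) * (l * B) + (- \<i> * (b / 4 * Q)) * (- s * A) - ((- s * A) * (\<i> * (b / 4 * P)) + (l * (1 / B)) * (m / 4 * (l * (B / A) + A / B / l)))"
    unfolding D by (simp only: diff_self mult_zero_right add_0_right)
next
  have "l * (\<i> * - (b / 4 * (W - U)) * (1 / B)) =
      (m / 4 * (l * (1 / (A * B)) + A * B / l)) * (s * (1 / A)) + (- \<i> * (b / 4 * Q)) * (l * (1 / B)) - ((- s * A) * (- (m / 4) * (l * (A / B) + B / A / l)) + (l * (1 / B)) * (- \<i> * (b / 4 * P)))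
      + (m * s * l / (4 * B)) * (A * A - 1 / (A * A) - 2 * \<i> * SH)"
    unfolding P_def Q_def using nz by (simp add: divide_simps) algebra
  then show "l * (\<i> * - (b / 4 * (W - U)) * (1 / B)) =
      (m / 4 * (l * (1 / (A * B)) + A * B / l)) * (s * (1 / A)) + (- \<i> * (b / 4 * Q)) * (l * (1 / B)) - ((- s * A) * (- (m / 4) * (l * (A / B) + B / A / l)) + (l * (1 / B)) * (- \<i> * (b / 4 * P)))"
    unfolding H by (simp only: diff_self mult_zero_right add_0_right)
qed

lemma cis_minus_eq: "cis (- x) = 1 / cis x"
  by (metis cis_inverse inverse_eq_divide)

lemma cis_half_angle_diff:
  "cis (x / 2) * cis (x / 2) - 1 / (cis (x / 2) * cis (x / 2)) = 2 * \<i> * complex_of_real (sin x)"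
  by (simp add: cis_mult cis_minus_eq[symmetric] complex_eq_iff)

lemma defect_K_has_vector_derivative:
  assumes b: "\<beta> \<noteq> 0" and s: "\<sigma> \<noteq> 0" and l: "l \<noteq> 0"
    and u: "\<And>t. (u has_real_derivative deriv u t) (at t)"
    and v: "\<And>t. (v has_real_derivative deriv v t) (at t)"
  shows "(defect_K \<beta> \<sigma> u v l has_vector_derivative
    lax_V m \<beta> v (defect_q m \<beta> \<sigma> u v) l t ** defect_K \<beta> \<sigma> u v l t
    - defect_K \<beta> \<sigma> u v l t ** lax_V m \<beta> u (defect_p m \<beta> \<sigma> u v) l t) (at t)"
proof -
  define A B where "A = cis (half_sum \<beta> u v t / 2)" and "B = cis (half_diff \<beta> u v t / 2)"
  have nz: "A \<noteq> 0" "B \<noteq> 0" by (simp_all add: A_def B_def)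
  have inv: "cis (- (half_sum \<beta> u v t / 2)) = 1 / A" "cis (- (half_diff \<beta> u v t / 2)) = 1 / B"
    unfolding A_def B_def by (rule cis_minus_eq)+
  have "\<beta> * u t / 2 = half_sum \<beta> u v t / 2 - half_diff \<beta> u v t / 2"
    "\<beta> * v t / 2 = half_sum \<beta> u v t / 2 + half_diff \<beta> u v t / 2"
    by (simp_all add: half_sum_def half_diff_def field_simps)
  then have "cis (\<beta> * u t / 2) = A / B" "cis (\<beta> * v t / 2) = A * B"
    unfolding A_def B_def cis_divide cis_mult by (simp_all only:)
  then have AB: "cis (\<beta> * u t / 2) = A / B" "cis (\<beta> * v t / 2) = A * B"
    "cis (- (\<beta> * u t / 2)) = B / A" "cis (- (\<beta> * v t / 2)) = 1 / (A * B)"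
    by (simp_all add: cis_minus_eq)
  have dhs: "((\<lambda>t. half_sum \<beta> u v t / 2) has_real_derivative \<beta> / 4 * (deriv v t + deriv u t)) (at t)"
    "((\<lambda>t. - (half_sum \<beta> u v t / 2)) has_real_derivative - (\<beta> / 4 * (deriv v t + deriv u t))) (at t)"
    "((\<lambda>t. half_diff \<beta> u v t / 2) has_real_derivative \<beta> / 4 * (deriv v t - deriv u t)) (at t)"
    "((\<lambda>t. - (half_diff \<beta> u v t / 2)) has_real_derivative - (\<beta> / 4 * (deriv v t - deriv u t))) (at t)"
    unfolding half_sum_def half_diff_def
    by (rule derivative_eq_intros u v refl | simp add: field_simps)+
  note D = mat2_has_vector_derivative[OF
      has_vector_derivative_mult_right[OF cis_has_vector_derivative[OF dhs(3)], of "of_real l"]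
      has_vector_derivative_mult_right[OF cis_has_vector_derivative[OF dhs(2)], of "of_real \<sigma>"]
      has_vector_derivative_mult_right[OF cis_has_vector_derivative[OF dhs(1)], of "- of_real \<sigma>"]
      has_vector_derivative_mult_right[OF cis_has_vector_derivative[OF dhs(4)], of "of_real l"]]
  have H: "A * A - 1 / (A * A) = 2 * \<i> * of_real (sin (half_sum \<beta> u v t))"
    "B * B - 1 / (B * B) = 2 * \<i> * of_real (sin (half_diff \<beta> u v t))"
    unfolding A_def B_def by (rule cis_half_angle_diff)+
  show ?thesis
    using D zero_curvature_algebra[OF nz _ _ _ H, of "of_real l" "of_real \<beta>" "of_real \<sigma>"
        "of_real (deriv v t)" "of_real (deriv u t)" "of_real m"] b s l
    unfolding defect_K_def[abs_def] lax_V_mat2 defect_p_def defect_q_def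
      A_def[symmetric] B_def[symmetric] inv AB
    by simp
qed

text \<open>Exchanging the fields and the sign of \<sigma> yields the adjugate. The inverse is thus
  again of defect type, and the frame limit below covers both ends of the time axis.\<close>

lemma defect_K_inverse:
  assumes "l \<noteq> 0"
  shows "defect_K \<beta> \<sigma> u v l t **
    (of_real (1 / (l\<^sup>2 + \<sigma>\<^sup>2)) \<odot> defect_K \<beta> (- \<sigma>) v u l t) = mat 1"
proof -
  define c where "c = complex_of_real (1 / (l\<^sup>2 + \<sigma>\<^sup>2))"
  have "l\<^sup>2 + \<sigma>\<^sup>2 \<noteq> 0" using assms by (simp add: sum_power2_eq_zero_iff)
  then have "1 / (l\<^sup>2 + \<sigma>\<^sup>2) * (l * l + \<sigma> * \<sigma>) = 1" by (simp add: power2_eq_square)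
  then have c: "c * (of_real l * of_real l + of_real \<sigma> * of_real \<sigma>) = 1"
    unfolding c_def of_real_mult[symmetric] of_real_add[symmetric] by simp
  have hd: "half_diff \<beta> v u t / 2 = - (half_diff \<beta> u v t / 2)" "half_sum \<beta> v u t = half_sum \<beta> u v t"
    by (simp_all add: half_diff_def half_sum_def field_simps)
  have ab: "cis (half_diff \<beta> u v t / 2) * cis (- (half_diff \<beta> u v t / 2)) = 1"
    "cis (half_sum \<beta> u v t / 2) * cis (- (half_sum \<beta> u v t / 2)) = 1"
    by (simp_all add: cis_mult)
  show ?thesis
    unfolding defect_K_def hd mat2_cscale mat2_mult mat2_one mat2_eq_iff c_def[symmetric]
      of_real_minus minus_minus
    using c ab by (intro conjI) ((simp only: minus_minus)?, (simp add: mult_ac; fail) | algebra)+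
qed

text \<open>The sign \<epsilon> of the overview, which is the common value of the cosines of
  \<open>half_sum\<close> and \<open>half_diff\<close> in the vacuum.\<close>

definition defect_sign :: "int \<Rightarrow> int \<Rightarrow> real" where
  "defect_sign Q Qt = (if even (Q + Qt) then 1 else - 1)"

lemma defect_sign_swap: "defect_sign Qt Q = defect_sign Q Qt"
  by (simp add: defect_sign_def add.commute)

lemma cis_pi_of_int: "cis (pi * of_int n) = (if even n then 1 else - 1)"
proof (cases "even n")
  case True
  then obtain k where "n = 2 * k" by blast
  then show ?thesis using cis_multiple_2pi[of "of_int k"] by (simp add: mult_ac)
next
  case False
  then obtain k where "n = 2 * k + 1" by (elim oddE)
  then have "cis (pi * of_int n) = cis (2 * pi * of_int k) * cis pi"
    unfolding cis_mult by (simp add: algebra_simps)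
  then show ?thesis using False by simp
qed

text \<open>In the frame \<open>E_mat\<close> of the vacuum at an end of the time axis, the limit of \<open>defect_K\<close> is
  \<open>l + \<i> \<sigma> \<epsilon> \<sigma>\<^sub>3\<close>; being diagonal, it commutes with the oscillating factors, and what
  remains off the diagonal tends to 0 against bounded oscillations.\<close>

lemma defect_K_frame_tendsto:
  assumes b: "\<beta> \<noteq> 0"
    and u: "(u \<longlongrightarrow> 2 * pi * of_int Q / \<beta>) F" and v: "(v \<longlongrightarrow> 2 * pi * of_int Qt / \<beta>) F"
  shows "((\<lambda>t. E_inv m Qt l t ** defect_K \<beta> \<sigma> u v l t ** E_mat m Q l t) \<longlongrightarrow>
    mat2 (Complex l (\<sigma> * defect_sign Q Qt)) 0 0 (Complex l (- \<sigma> * defect_sign Q Qt))) F"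
proof -
  define x y where "x = cis (pi / 2 * of_int Q)" and "y = cis (pi / 2 * of_int Qt)"
  define d where "d = complex_of_real (defect_sign Q Qt)"
  \<comment> \<open>\<open>X\<close> is the conjugated matrix without the oscillating factors:
    conjugation with them leaves its diagonal alone and multiplies the other two entries by
    phases.\<close>
  define X where "X t = N_inv ** exp_pauli3 (- \<i> * of_real (pi / 2 * of_int Qt)) **
      defect_K \<beta> \<sigma> u v l t ** exp_pauli3 (\<i> * of_real (pi / 2 * of_int Q)) ** N_mat" for t
  define w where "w t = exp (\<i> * of_real (k0 m l * t))" for t
  have xy: "x \<noteq> 0" "y \<noteq> 0" by (simp_all add: x_def y_def)
  have "x * x * y * y = cis (pi * of_int (Q + Qt))"
    by (simp add: x_def y_def cis_mult algebra_simps)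
  then have xyd: "x * x * y * y = d"
    unfolding cis_pi_of_int by (simp add: d_def defect_sign_def)
  have dd: "d * d = 1" by (simp add: d_def defect_sign_def)
  have ex: "exp_pauli3 (\<i> * of_real (pi / 2 * of_int Q)) = mat2 x 0 0 (1 / x)"
    "exp_pauli3 (- \<i> * of_real (pi / 2 * of_int Qt)) = mat2 (1 / y) 0 0 y"
    by (simp_all add: exp_pauli3_mat2 x_def y_def cis_conv_exp exp_minus inverse_eq_divide)
  have "(half_sum \<beta> u v \<longlongrightarrow> \<beta> * (2 * pi * of_int Qt / \<beta> + 2 * pi * of_int Q / \<beta>) / 2) F"
    "(half_diff \<beta> u v \<longlongrightarrow> \<beta> * (2 * pi * of_int Qt / \<beta> - 2 * pi * of_int Q / \<beta>) / 2) F"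
    unfolding half_sum_def[abs_def] half_diff_def[abs_def] by (intro tendsto_intros u v; simp)+
  moreover have "\<beta> * (2 * pi * of_int Qt / \<beta> + 2 * pi * of_int Q / \<beta>) / 2 = pi * of_int Qt + pi * of_int Q"
    "\<beta> * (2 * pi * of_int Qt / \<beta> - 2 * pi * of_int Q / \<beta>) / 2 = pi * of_int Qt - pi * of_int Q"
    using b by (simp_all add: field_simps)
  ultimately have lim: "(half_sum \<beta> u v \<longlongrightarrow> pi * of_int Qt + pi * of_int Q) F"
    "(half_diff \<beta> u v \<longlongrightarrow> pi * of_int Qt - pi * of_int Q) F"
    by (simp_all only:)
  have cis_lim: "((\<lambda>t. cis (f t)) \<longlongrightarrow> cis c) F" if "(f \<longlongrightarrow> c) F" for f c
    unfolding cis_conv_exp by (intro tendsto_intros that)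
  have K: "(defect_K \<beta> \<sigma> u v l \<longlongrightarrow> mat2 (of_real l * (y / x)) (of_real \<sigma> * (1 / (x * y)))
      (- of_real \<sigma> * (x * y)) (of_real l * (x / y))) F"
  proof -
    have "cis ((pi * of_int Qt - pi * of_int Q) / 2) = y / x"
      "cis ((pi * of_int Qt + pi * of_int Q) / 2) = x * y"
      unfolding x_def y_def cis_divide cis_mult by (simp_all add: field_simps)
    then have "cis ((pi * of_int Qt - pi * of_int Q) / 2) = y / x"
      "cis ((pi * of_int Qt + pi * of_int Q) / 2) = x * y"
      "cis (- ((pi * of_int Qt + pi * of_int Q) / 2)) = 1 / (x * y)"
      "cis (- ((pi * of_int Qt - pi * of_int Q) / 2)) = x / y"
      by (simp_all add: cis_minus_eq)
    moreover have "(defect_K \<beta> \<sigma> u v l \<longlongrightarrow> mat2 (of_real l * cis ((pi * of_int Qt - pi * of_int Q) / 2))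
        (of_real \<sigma> * cis (- ((pi * of_int Qt + pi * of_int Q) / 2)))
        (- of_real \<sigma> * cis ((pi * of_int Qt + pi * of_int Q) / 2))
        (of_real l * cis (- ((pi * of_int Qt - pi * of_int Q) / 2)))) F"
      unfolding defect_K_def[abs_def] by (intro mat2_tendsto tendsto_mult tendsto_const cis_lim
          tendsto_minus tendsto_divide lim) auto
    ultimately show ?thesis by simp
  qed
  have X: "(X \<longlongrightarrow> mat2 (of_real l + \<i> * of_real \<sigma> * d) 0 0 (of_real l - \<i> * of_real \<sigma> * d)) F"
  proof -
    \<comment> \<open>The square of \<open>x * y\<close> is the sign \<open>d\<close>, so inverting
      \<open>x * y\<close> amounts to multiplying it by \<open>d\<close>.\<close>
    have "of_real \<sigma> * (1 / (x * y)) = of_real \<sigma> * d * (x * y)"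
      using xy dd unfolding xyd[symmetric] by (simp add: field_simps)
    then have M: "mat2 (1 / y) 0 0 y ** mat2 (of_real l * (y / x)) (of_real \<sigma> * (1 / (x * y)))
        (- of_real \<sigma> * (x * y)) (of_real l * (x / y)) ** mat2 x 0 0 (1 / x)
      = mat2 (of_real l) (of_real \<sigma> * d) (- of_real \<sigma> * d) (of_real l)"
      unfolding mat2_mult mat2_eq_iff using xy xyd by (auto simp: field_simps)
    have "(X \<longlongrightarrow> N_inv ** mat2 (1 / y) 0 0 y ** mat2 (of_real l * (y / x)) (of_real \<sigma> * (1 / (x * y)))
      (- of_real \<sigma> * (x * y)) (of_real l * (x / y)) ** mat2 x 0 0 (1 / x) ** N_mat) F"
      unfolding X_def[abs_def] ex by (intro tendsto_matrix_mult tendsto_const K)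
    also have "N_inv ** mat2 (1 / y) 0 0 y ** mat2 (of_real l * (y / x)) (of_real \<sigma> * (1 / (x * y)))
      (- of_real \<sigma> * (x * y)) (of_real l * (x / y)) ** mat2 x 0 0 (1 / x) ** N_mat
      = N_inv ** mat2 (of_real l) (of_real \<sigma> * d) (- of_real \<sigma> * d) (of_real l) ** N_mat"
      unfolding M[symmetric] by (simp add: matrix_mul_assoc)
    also have "\<dots> = mat2 (of_real l + \<i> * of_real \<sigma> * d) 0 0 (of_real l - \<i> * of_real \<sigma> * d)"
    proof -
      define h where "h = complex_of_real (1 / sqrt 2)"
      have h: "h * h = 1 / 2" unfolding h_def by (rule half_sqrt2)
      have "N_inv ** mat2 (of_real l) (of_real \<sigma> * d) (- of_real \<sigma> * d) (of_real l) ** N_mat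
        = mat2 (2 * (h * h) * (of_real l + \<i> * of_real \<sigma> * d)) 0 0
            (2 * (h * h) * (of_real l - \<i> * of_real \<sigma> * d))"
        unfolding N_inv_def N_mat_mat2 h_def[symmetric] mat2_mult mat2_eq_iff
        by (auto simp: algebra_simps)
      then show ?thesis unfolding h by simp
    qed
    finally show ?thesis .
  qed
  have "norm (w t) = 1" for t unfolding w_def by (simp add: norm_exp_imaginary)
  then have w1: "norm (w t * w t) = 1" "norm (1 / (w t * w t)) = 1" for t
    by (simp_all add: norm_mult norm_divide)
  have conj: "E_inv m Qt l t ** defect_K \<beta> \<sigma> u v l t ** E_mat m Q l t =
      mat2 (X t $ 1 $ 1) (w t * w t * X t $ 1 $ 2) (1 / (w t * w t) * X t $ 2 $ 1) (X t $ 2 $ 2)" for t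
  proof -
    have "E_inv m Qt l t ** defect_K \<beta> \<sigma> u v l t ** E_mat m Q l t
        = exp_pauli3 (\<i> * of_real (k0 m l * t)) ** X t ** exp_pauli3 (- \<i> * of_real (k0 m l * t))"
      by (simp add: E_inv_def E_mat_def X_def matrix_mul_assoc)
    also have "\<dots> = mat2 (w t) 0 0 (1 / w t) ** X t ** mat2 (1 / w t) 0 0 (w t)"
      by (simp add: exp_pauli3_mat2 w_def exp_minus inverse_eq_divide)
    also have "\<dots> = mat2 (X t $ 1 $ 1) (w t * w t * X t $ 1 $ 2) (1 / (w t * w t) * X t $ 2 $ 1) (X t $ 2 $ 2)"
      by (rule mat2_eqI) (simp_all add: mult_nth2 w_def)
    finally show ?thesis .
  qed
  have osc: "((\<lambda>t. g t * f t) \<longlongrightarrow> 0) F" if "(f \<longlongrightarrow> 0) F" "\<And>t. norm (g t) = 1"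
    for f g :: "real \<Rightarrow> complex"
    by (rule Lim_null_comparison[OF _ tendsto_norm_zero[OF that(1)]]) (simp add: norm_mult that(2))
  have X': "((\<lambda>t. X t $ i $ j) \<longlongrightarrow>
      mat2 (of_real l + \<i> * of_real \<sigma> * d) 0 0 (of_real l - \<i> * of_real \<sigma> * d) $ i $ j) F" for i j
    by (intro tendsto_vec_nth X)
  have "((\<lambda>t. E_inv m Qt l t ** defect_K \<beta> \<sigma> u v l t ** E_mat m Q l t) \<longlongrightarrow>
      mat2 (of_real l + \<i> * of_real \<sigma> * d) 0 0 (of_real l - \<i> * of_real \<sigma> * d)) F"
    unfolding conj using X'[of 1 1] X'[of 1 2] X'[of 2 1] X'[of 2 2]
    by (intro mat2_tendsto osc w1) auto
  moreover have "of_real l + \<i> * of_real \<sigma> * d = Complex l (\<sigma> * defect_sign Q Qt)"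
    "of_real l - \<i> * of_real \<sigma> * d = Complex l (- \<sigma> * defect_sign Q Qt)"
    by (simp_all add: d_def complex_eq_iff)
  ultimately show ?thesis by simp
qed

section \<open>Transformation of the monodromy matrix\<close>

definition monodromy_factor :: "real \<Rightarrow> int \<Rightarrow> int \<Rightarrow> int \<Rightarrow> int \<Rightarrow> real \<Rightarrow> complex" where
  "monodromy_factor \<sigma> Qm Qp Qtm Qtp l =
     Complex l (\<sigma> * defect_sign Qp Qtp) / Complex l (\<sigma> * defect_sign Qm Qtm)"

text \<open>Seen in the vacuum frames, the gauge matrix at late times and its inverse at early times
  have diagonal limits \<open>?Dp\<close> and \<open>c\<close> times \<open>?Dm\<close>.
  Multiplication by diagonal matrices on both sides merely rescales the (1,1) entry.\<close>

lemma is_time_monodromy_defect: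
  assumes b: "\<beta> \<noteq> 0" and s: "\<sigma> \<noteq> 0" and l: "l \<noteq> 0"
    and u: "field_boundary \<beta> Qm Qp u" and v: "field_boundary \<beta> Qtm Qtp v"
    and M: "is_time_monodromy m \<beta> Qm Qp u (defect_p m \<beta> \<sigma> u v) l M"
  shows "\<exists>Mt. is_time_monodromy m \<beta> Qtm Qtp v (defect_q m \<beta> \<sigma> u v) l Mt \<and>
    Mt $ 1 $ 1 = monodromy_factor \<sigma> Qm Qp Qtm Qtp l * M $ 1 $ 1"
proof -
  let ?V = "lax_V m \<beta> u (defect_p m \<beta> \<sigma> u v) l" and ?W = "lax_V m \<beta> v (defect_q m \<beta> \<sigma> u v) l"
  let ?Dp = "mat2 (Complex l (\<sigma> * defect_sign Qp Qtp)) 0 0 (Complex l (- \<sigma> * defect_sign Qp Qtp))"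
  let ?Dm = "mat2 (Complex l (- \<sigma> * defect_sign Qtm Qm)) 0 0 (Complex l (- (- \<sigma>) * defect_sign Qtm Qm))"
  define c where "c = complex_of_real (1 / (l\<^sup>2 + \<sigma>\<^sup>2))"
  define G H where "G = defect_K \<beta> \<sigma> u v l" and "H t = c \<odot> defect_K \<beta> (- \<sigma>) v u l t" for t
  obtain T where T: "transition_matrix ?V T"
    and lim: "((\<lambda>(t, \<tau>). matrix_inv (E_mat m Qp l t) ** T t \<tau> ** E_mat m Qm l \<tau>) \<longlongrightarrow> M)
          (at_top \<times>\<^sub>F at_bot)"
    using M unfolding is_time_monodromy_def by blast
  define S where "S t \<tau> = G t ** T t \<tau> ** H \<tau>" for t \<tau>
  have S: "transition_matrix ?W S"
    unfolding S_def[abs_def]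
  proof (rule transition_matrix_gauge[OF T])
    show "(G has_vector_derivative ?W t ** G t - G t ** ?V t) (at t)" for t
      unfolding G_def using b s l field_boundary_DERIV[OF u] field_boundary_DERIV[OF v]
      by (rule defect_K_has_vector_derivative)
    show "G t ** H t = mat 1" for t unfolding G_def H_def c_def by (rule defect_K_inverse[OF l])
  qed
  have cs: "A ** (c \<odot> B) = c \<odot> (A ** B)" "(c \<odot> A) ** B = c \<odot> (A ** B)" for A B :: "complex^2^2"
    by (rule mat2_eqI; simp add: mult_nth2 cscale_def algebra_simps)+
  have "((\<lambda>t. E_inv m Qtp l t ** G t ** E_mat m Qp l t) \<longlongrightarrow> ?Dp) at_top"
    unfolding G_def using b field_boundary_tendsto(2)[OF u] field_boundary_tendsto(2)[OF v]
    by (rule defect_K_frame_tendsto)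
  then have Gp: "((\<lambda>z. E_inv m Qtp l (fst z) ** G (fst z) ** E_mat m Qp l (fst z)) \<longlongrightarrow> ?Dp)
      (at_top \<times>\<^sub>F at_bot)"
    by (rule filterlim_compose[OF _ filterlim_fst])
  have "((\<lambda>t. E_inv m Qm l t ** defect_K \<beta> (- \<sigma>) v u l t ** E_mat m Qtm l t) \<longlongrightarrow> ?Dm) at_bot"
    using b field_boundary_tendsto(1)[OF v] field_boundary_tendsto(1)[OF u]
    by (rule defect_K_frame_tendsto)
  then have Gm: "((\<lambda>z. E_inv m Qm l (snd z) ** defect_K \<beta> (- \<sigma>) v u l (snd z) ** E_mat m Qtm l (snd z))
      \<longlongrightarrow> ?Dm) (at_top \<times>\<^sub>F at_bot)"
    by (rule filterlim_compose[OF _ filterlim_snd])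
  have cb: "bounded_linear (\<lambda>A. c \<odot> A)"
    unfolding linear_conv_bounded_linear[symmetric]
    by (auto intro!: linearI mat2_eqI simp: cscale_def algebra_simps)
  have "((\<lambda>z. c \<odot> ((E_inv m Qtp l (fst z) ** G (fst z) ** E_mat m Qp l (fst z)) **
      (case z of (t, \<tau>) \<Rightarrow> matrix_inv (E_mat m Qp l t) ** T t \<tau> ** E_mat m Qm l \<tau>) **
      (E_inv m Qm l (snd z) ** defect_K \<beta> (- \<sigma>) v u l (snd z) ** E_mat m Qtm l (snd z))))
    \<longlongrightarrow> c \<odot> (?Dp ** M ** ?Dm)) (at_top \<times>\<^sub>F at_bot)"
    by (intro bounded_linear.tendsto[OF cb] tendsto_matrix_mult Gp lim Gm)
  moreover have "c \<odot> ((E_inv m Qtp l (fst z) ** G (fst z) ** E_mat m Qp l (fst z)) **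
      (case z of (t, \<tau>) \<Rightarrow> matrix_inv (E_mat m Qp l t) ** T t \<tau> ** E_mat m Qm l \<tau>) **
      (E_inv m Qm l (snd z) ** defect_K \<beta> (- \<sigma>) v u l (snd z) ** E_mat m Qtm l (snd z)))
    = (case z of (t, \<tau>) \<Rightarrow> matrix_inv (E_mat m Qtp l t) ** S t \<tau> ** E_mat m Qtm l \<tau>)" for z
  proof (cases z)
    case (Pair t \<tau>)
    \<comment> \<open>Each \<open>E_mat\<close> of the untilded side meets its own inverse and
      cancels; what remains are the tilded frames around the gauged transition matrix.\<close>
    have "(E_inv m Qtp l t ** G t ** E_mat m Qp l t) ** (E_inv m Qp l t ** T t \<tau> ** E_mat m Qm l \<tau>) **
        (E_inv m Qm l \<tau> ** defect_K \<beta> (- \<sigma>) v u l \<tau> ** E_mat m Qtm l \<tau>)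
      = E_inv m Qtp l t ** G t ** (E_mat m Qp l t ** E_inv m Qp l t) ** T t \<tau> **
        (E_mat m Qm l \<tau> ** E_inv m Qm l \<tau>) ** defect_K \<beta> (- \<sigma>) v u l \<tau> ** E_mat m Qtm l \<tau>"
      by (simp add: matrix_mul_assoc)
    also have "\<dots> = E_inv m Qtp l t ** G t ** T t \<tau> ** defect_K \<beta> (- \<sigma>) v u l \<tau> ** E_mat m Qtm l \<tau>"
      by (simp add: E_mat_inv)
    finally show ?thesis
      by (simp add: Pair matrix_inv_E_mat S_def H_def cs matrix_mul_assoc)
  qed
  ultimately have "is_time_monodromy m \<beta> Qtm Qtp v (defect_q m \<beta> \<sigma> u v) l (c \<odot> (?Dp ** M ** ?Dm))"
    unfolding is_time_monodromy_def using S by auto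
  moreover have "(c \<odot> (?Dp ** M ** ?Dm)) $ 1 $ 1 = monodromy_factor \<sigma> Qm Qp Qtm Qtp l * M $ 1 $ 1"
  proof -
    have "defect_sign Qm Qtm * defect_sign Qm Qtm = 1" by (simp add: defect_sign_def)
    \<comment> \<open>The determinant is the squared modulus of the frame factor at early times, so
      \<open>c\<close> times the conjugate of that factor is its reciprocal.\<close>
    then have "complex_of_real (l\<^sup>2 + \<sigma>\<^sup>2) =
        Complex l (\<sigma> * defect_sign Qm Qtm) * Complex l (- \<sigma> * defect_sign Qtm Qm)"
      by (simp add: complex_eq_iff power2_eq_square defect_sign_swap[of Qtm] mult.assoc mult.left_commute)
    moreover have "Complex l x \<noteq> 0" for x using l by (simp add: complex_eq_iff)
    ultimately have "c * Complex l (- \<sigma> * defect_sign Qtm Qm) = 1 / Complex l (\<sigma> * defect_sign Qm Qtm)"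
      by (simp add: c_def of_real_divide field_simps)
    moreover have "(c \<odot> (?Dp ** M ** ?Dm)) $ 1 $ 1 = Complex l (\<sigma> * defect_sign Qp Qtp) * M $ 1 $ 1 *
        (c * Complex l (- \<sigma> * defect_sign Qtm Qm))"
      by (simp add: cscale_def mult_nth2)
    ultimately show ?thesis by (simp add: monodromy_factor_def)
  qed
  ultimately show ?thesis by blast
qed

lemma is_time_monodromy_unique:
  assumes "is_time_monodromy m \<beta> Qm Qp u p l M" and "is_time_monodromy m \<beta> Qm Qp u p l M'"
  shows "M = M'"
proof -
  have tr: "lax_V m \<beta> u p l t $ 1 $ 1 + lax_V m \<beta> u p l t $ 2 $ 2 = 0" for t
    by (simp add: lax_V_mat2)
  have "at_top \<times>\<^sub>F at_bot \<noteq> (bot :: (real \<times> real) filter)"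
    by (simp add: prod_filter_eq_bot)
  moreover obtain T where T: "transition_matrix (lax_V m \<beta> u p l) T"
    "((\<lambda>(t, \<tau>). matrix_inv (E_mat m Qp l t) ** T t \<tau> ** E_mat m Qm l \<tau>) \<longlongrightarrow> M) (at_top \<times>\<^sub>F at_bot)"
    using assms(1) unfolding is_time_monodromy_def by blast
  moreover obtain T' where T': "transition_matrix (lax_V m \<beta> u p l) T'"
    "((\<lambda>(t, \<tau>). matrix_inv (E_mat m Qp l t) ** T' t \<tau> ** E_mat m Qm l \<tau>) \<longlongrightarrow> M') (at_top \<times>\<^sub>F at_bot)"
    using assms(2) unfolding is_time_monodromy_def by blast
  moreover have "T = T'" by (rule transition_matrix_unique[OF tr T(1) T'(1)])
  ultimately show ?thesis using tendsto_unique by blast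
qed


section \<open>Asymptotic expansions\<close>

text \<open>Poincare expansions in a small quantity \<open>z\<close>, serving both ends of the
  spectrum: \<open>z = 1 / l\<close> at infinity and \<open>z = l\<close> at 0.\<close>

definition has_expansion ::
    "real filter \<Rightarrow> (real \<Rightarrow> complex) \<Rightarrow> (real \<Rightarrow> complex) \<Rightarrow> (nat \<Rightarrow> complex) \<Rightarrow> bool" where
  "has_expansion F z f c \<longleftrightarrow> (\<forall>N. (\<lambda>l. f l - (\<Sum>n\<le>N. c n * z l ^ n)) \<in> o[F](\<lambda>l. z l ^ N))"

lemma has_expansion_add:
  assumes "has_expansion F z f c" and "has_expansion F z g d"
  shows "has_expansion F z (\<lambda>l. f l + g l) (\<lambda>n. c n + d n)"
  unfolding has_expansion_def
proof
  fix N
  have "(\<lambda>l. (f l - (\<Sum>n\<le>N. c n * z l ^ n)) + (g l - (\<Sum>n\<le>N. d n * z l ^ n))) \<in> o[F](\<lambda>l. z l ^ N)"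
    using sum_in_smallo(1)[OF assms[unfolded has_expansion_def, THEN spec]] .
  then show "(\<lambda>l. f l + g l - (\<Sum>n\<le>N. (c n + d n) * z l ^ n)) \<in> o[F](\<lambda>l. z l ^ N)"
    by (simp add: distrib_right sum.distrib algebra_simps)
qed

lemma has_expansion_diff:
  assumes "has_expansion F z f c" and "has_expansion F z g d"
  shows "has_expansion F z (\<lambda>l. f l - g l) (\<lambda>n. c n - d n)"
  unfolding has_expansion_def
proof
  fix N
  have "(\<lambda>l. (f l - (\<Sum>n\<le>N. c n * z l ^ n)) - (g l - (\<Sum>n\<le>N. d n * z l ^ n))) \<in> o[F](\<lambda>l. z l ^ N)"
    using sum_in_smallo(2)[OF assms[unfolded has_expansion_def, THEN spec]] .
  then show "(\<lambda>l. f l - g l - (\<Sum>n\<le>N. (c n - d n) * z l ^ n)) \<in> o[F](\<lambda>l. z l ^ N)"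
    by (simp add: left_diff_distrib sum_subtractf algebra_simps)
qed

lemma has_expansion_const: "has_expansion F z (\<lambda>l. k) (\<lambda>n. if n = 0 then k else 0)"
  unfolding has_expansion_def
proof
  fix N
  have "(\<Sum>n\<le>N. (if n = 0 then k else 0) * z l ^ n) = k" for l
  proof -
    have "(\<Sum>n\<le>N. (if n = 0 then k else 0) * z l ^ n) = (\<Sum>n\<le>N. if n = 0 then k else 0)"
      by (intro sum.cong) auto
    then show ?thesis by simp
  qed
  then show "(\<lambda>l. k - (\<Sum>n\<le>N. (if n = 0 then k else 0) * z l ^ n)) \<in> o[F](\<lambda>l. z l ^ N)" by simp
qed

lemma sum_atMost_split_last: "(\<Sum>n\<le>N. f n) = (\<Sum>n<N. f n) + f N" for N :: nat
  by (simp only: lessThan_Suc_atMost[symmetric] sum.lessThan_Suc)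

text \<open>After removal of the first \<open>N\<close> terms and division by the
  \<open>N\<close>-th power, what is left is a power series with constant term \<open>c N\<close>.
  Its limit identifies the next term and leaves an error of smaller order.\<close>

lemma has_expansion_power_series:
  assumes r: "r > 0" and sums: "\<And>x. norm x < r \<Longrightarrow> (\<lambda>n. c n * x ^ n) sums f x"
    and z: "(z \<longlongrightarrow> 0) F" and nz: "\<forall>\<^sub>F l in F. z l \<noteq> 0"
  shows "has_expansion F z (\<lambda>l. f (z l)) c"
  unfolding has_expansion_def
proof
  fix N
  have "((\<lambda>x. (f x - (\<Sum>n<N. c n * x ^ n)) / x ^ N) \<longlongrightarrow> c (0 + N)) (at 0)"
  proof (rule powser_limit_0_strong[OF r])
    fix x :: complex assume x: "x \<noteq> 0" "norm x < r"
    have "(\<lambda>n. c (n + N) * x ^ (n + N) / x ^ N) sums ((f x - (\<Sum>n<N. c n * x ^ n)) / x ^ N)"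
      by (intro sums_divide sums_split_initial_segment sums x)
    then show "(\<lambda>n. c (n + N) * x ^ n) sums ((f x - (\<Sum>n<N. c n * x ^ n)) / x ^ N)"
      using x by (simp add: power_add)
  qed
  then have "((\<lambda>l. (f (z l) - (\<Sum>n<N. c n * z l ^ n)) / z l ^ N) \<longlongrightarrow> c N) F"
    by (intro filterlim_compose[of _ "nhds (c N)" "at 0" z]) (auto simp: filterlim_at z nz)
  then have "((\<lambda>l. (f (z l) - (\<Sum>n<N. c n * z l ^ n)) / z l ^ N - c N) \<longlongrightarrow> 0) F"
    by (rule LIM_zero)
  moreover have "\<forall>\<^sub>F l in F. (f (z l) - (\<Sum>n<N. c n * z l ^ n)) / z l ^ N - c N
      = (f (z l) - (\<Sum>n\<le>N. c n * z l ^ n)) / z l ^ N"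
    using nz by eventually_elim (simp add: sum_atMost_split_last diff_divide_distrib add_divide_distrib)
  ultimately have "((\<lambda>l. (f (z l) - (\<Sum>n\<le>N. c n * z l ^ n)) / z l ^ N) \<longlongrightarrow> 0) F"
    by (rule Lim_transform_eventually)
  moreover have "\<forall>\<^sub>F l in F. z l ^ N \<noteq> 0" using nz by eventually_elim simp
  ultimately show "(\<lambda>l. f (z l) - (\<Sum>n\<le>N. c n * z l ^ n)) \<in> o[F](\<lambda>l. z l ^ N)"
    by (rule smalloI_tendsto)
qed

text \<open>Taylor coefficients of \<open>Ln (1 + w * x)\<close> at 0. Division by 0 yields 0, so
  the coefficient at \<open>n = 0\<close> is 0, as it should be.\<close>

definition ln_coeff :: "complex \<Rightarrow> nat \<Rightarrow> complex" where
  "ln_coeff w n = - ((- w) ^ n) / of_nat n"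

lemma has_expansion_Ln:
  assumes w: "w \<noteq> 0" and "(z \<longlongrightarrow> 0) F" and "\<forall>\<^sub>F l in F. z l \<noteq> 0"
  shows "has_expansion F z (\<lambda>l. Ln (1 + w * z l)) (ln_coeff w)"
proof (rule has_expansion_power_series[where f = "\<lambda>x. Ln (1 + w * x)"])
  show "1 / norm w > 0" using w by simp
  fix x :: complex assume "norm x < 1 / norm w"
  then have "norm (w * x) < 1" using w by (simp add: norm_mult field_simps)
  from Ln_series'[OF this] show "(\<lambda>n. ln_coeff w n * x ^ n) sums Ln (1 + w * x)"
    by (simp add: ln_coeff_def power_mult_distrib[symmetric])
qed (use assms in auto)

lemma has_expansion_tendsto:
  assumes "has_expansion F z f c" shows "(f \<longlongrightarrow> c 0) F"
proof -
  have "(\<lambda>l. f l - c 0) \<in> o[F](\<lambda>l. 1)"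
    using assms unfolding has_expansion_def by (elim allE[of _ 0]) simp
  then show ?thesis using smalloD_tendsto LIM_zero_cancel by fastforce
qed

text \<open>By induction on the order: once the lower coefficients agree, the error divided by the
  \<open>N\<close>-th power is the constant \<open>d N - c N\<close>, which has to tend to
  0.\<close>

lemma has_expansion_unique:
  assumes f: "has_expansion F z f c" and g: "has_expansion F z g d"
    and eq: "\<forall>\<^sub>F l in F. f l = g l" and nz: "\<forall>\<^sub>F l in F. z l \<noteq> 0" and F: "F \<noteq> bot"
  shows "c = d"
proof
  fix N show "c N = d N"
  proof (induction N rule: less_induct)
    case (less N)
    have "(\<lambda>l. f l - g l - (\<Sum>n\<le>N. (c n - d n) * z l ^ n)) \<in> o[F](\<lambda>l. z l ^ N)"
      using has_expansion_diff[OF f g] by (simp add: has_expansion_def)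
    then have "((\<lambda>l. (f l - g l - (\<Sum>n\<le>N. (c n - d n) * z l ^ n)) / z l ^ N) \<longlongrightarrow> 0) F"
      by (rule smalloD_tendsto)
    moreover have "\<forall>\<^sub>F l in F. (f l - g l - (\<Sum>n\<le>N. (c n - d n) * z l ^ n)) / z l ^ N = d N - c N"
      using eq nz
    proof eventually_elim
      case (elim l)
      have "(\<Sum>n\<le>N. (c n - d n) * z l ^ n) = (c N - d N) * z l ^ N"
        using less by (simp add: sum_atMost_split_last)
      then show ?case using elim by (simp add: minus_divide_left)
    qed
    ultimately have "((\<lambda>l. d N - c N) \<longlongrightarrow> 0) F" by (rule Lim_transform_eventually)
    then show ?case using F by (simp add: tendsto_const_iff)
  qed
qed

text \<open>Two logarithms of one function differ by integer multiples of 2 pi i. A common limit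
  brings the difference below 1, which leaves only the multiple 0.\<close>

lemma eventually_eq_if_exp_eq:
  fixes f g :: "real \<Rightarrow> complex"
  assumes "(f \<longlongrightarrow> c) F" and "(g \<longlongrightarrow> c) F" and eq: "\<forall>\<^sub>F l in F. exp (f l) = exp (g l)"
  shows "\<forall>\<^sub>F l in F. f l = g l"
proof -
  have "((\<lambda>l. f l - g l) \<longlongrightarrow> 0) F" using tendsto_diff[OF assms(1,2)] by simp
  then have "\<forall>\<^sub>F l in F. norm (f l - g l) < 1"
    using tendstoD[of "\<lambda>l. f l - g l" 0 F 1] by simp
  then show ?thesis using eq
  proof eventually_elim
    case (elim l)
    then have "exp (f l - g l) = 1" by (simp add: exp_diff)
    then obtain n :: int where Re0: "Re (f l - g l) = 0" and Im: "Im (f l - g l) = of_int (2 * n) * pi"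
      by (auto simp: exp_eq_1)
    have "\<bar>of_int (2 * n) * pi\<bar> < 1"
      using elim(1) abs_Im_le_cmod[of "f l - g l"] unfolding Im by linarith
    moreover have "n \<noteq> 0 \<Longrightarrow> \<bar>of_int (2 * n) * pi\<bar> \<ge> 2 * 1 * 3"
      unfolding of_int_mult abs_mult using pi_gt3 by (intro mult_mono) auto
    ultimately have "n = 0" by fastforce
    then show ?case using Re0 Im by (simp add: complex_eq_iff)
  qed
qed

section \<open>The integrals and their shifts\<close>

lemma time_integrals_alt:
  "time_integrals m \<beta> Qm Qp u p J \<longleftrightarrow>
     (\<exists>a :: real \<Rightarrow> complex.
        (\<forall>l. l \<noteq> 0 \<longrightarrow> (\<exists>M. is_time_monodromy m \<beta> Qm Qp u p l M \<and> a l = M $ 1 $ 1)) \<and>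
        (\<exists>L. (\<forall>\<^sub>F l in at_infinity. exp (L l) = a l) \<and>
          has_expansion at_infinity (\<lambda>l. 1 / of_real l) L (\<lambda>n. if n = 0 then 0 else \<i> * J (int n))) \<and>
        (\<exists>L. (\<forall>\<^sub>F l in at 0. exp (L l) = a l) \<and>
          has_expansion (at 0) of_real L (\<lambda>n. \<i> * J (- int n))) \<and>
        J 0 = of_real (- \<beta> / 2 * (Lim at_top u - Lim at_bot u)))"
proof -
  have 1: "\<i> * (\<Sum>n = 1..N. J (int n) / of_real l ^ n)
      = (\<Sum>n\<le>N. (if n = 0 then 0 else \<i> * J (int n)) * (1 / of_real l) ^ n)" for N and l :: real
  proof -
    have "(\<Sum>n\<le>N. (if n = 0 then 0 else \<i> * J (int n)) * (1 / of_real l) ^ n)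
        = (\<Sum>n = 1..N. (if n = 0 then 0 else \<i> * J (int n)) * (1 / of_real l) ^ n)"
      by (rule sum.mono_neutral_right) (auto simp: not_less_eq_eq)
    also have "\<dots> = (\<Sum>n = 1..N. \<i> * (J (int n) / of_real l ^ n))"
      by (intro sum.cong) (auto simp: power_one_over)
    finally show ?thesis by (simp add: sum_distrib_left)
  qed
  have 2: "\<i> * (\<Sum>n = 0..N. J (- int n) * of_real l ^ n) = (\<Sum>n\<le>N. \<i> * J (- int n) * of_real l ^ n)"
    for N and l :: real
    by (simp add: sum_distrib_left atMost_atLeast0 mult.assoc)
  show ?thesis
    unfolding time_integrals_def has_expansion_def 1 2 power_one_over ..
qed

lemma inverse_of_real_at_infinity:
  "((\<lambda>l. 1 / complex_of_real l) \<longlongrightarrow> 0) at_infinity" "\<forall>\<^sub>F l in at_infinity. 1 / complex_of_real l \<noteq> 0"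
proof -
  show "\<forall>\<^sub>F l in at_infinity. 1 / complex_of_real l \<noteq> 0"
    unfolding eventually_at_infinity by (rule exI[of _ 1]) auto
  have "((\<lambda>l. complex_of_real (inverse l)) \<longlongrightarrow> of_real 0) at_infinity"
    by (intro tendsto_of_real tendsto_inverse_0)
  then show "((\<lambda>l. 1 / complex_of_real l) \<longlongrightarrow> 0) at_infinity" by (simp add: inverse_eq_divide)
qed

lemma of_real_at_0: "(complex_of_real \<longlongrightarrow> 0) (at 0)" "\<forall>\<^sub>F l in at 0. complex_of_real l \<noteq> 0"
  using tendsto_of_real[OF tendsto_ident_at, of 0 UNIV] by (auto simp: eventually_at_filter)

lemma eventually_nonzero: "\<forall>\<^sub>F l in at_infinity. l \<noteq> (0::real)" "\<forall>\<^sub>F l in at 0. l \<noteq> (0::real)"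
proof -
  show "\<forall>\<^sub>F l in at_infinity. l \<noteq> (0::real)"
    unfolding eventually_at_infinity by (intro exI[of _ 1]) auto
  show "\<forall>\<^sub>F l in at 0. l \<noteq> (0::real)"
    by (simp add: eventually_at_filter)
qed

text \<open>The monodromy matrix determines \<open>a\<close> away from 0. The branch of the
  logarithm is pinned by its limit, which is 0 at infinity and \<open>\<i> * J 0\<close> at 0 with
  \<open>J 0\<close> prescribed by the field; then coefficients are unique.\<close>

lemma time_integrals_unique:
  assumes J: "time_integrals m \<beta> Qm Qp u p J" and K: "time_integrals m \<beta> Qm Qp u p K"
  shows "J = K"
proof -
  obtain a L L0 where a: "\<And>l. l \<noteq> 0 \<Longrightarrow> \<exists>M. is_time_monodromy m \<beta> Qm Qp u p l M \<and> a l = M $ 1 $ 1"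
    and L: "\<forall>\<^sub>F l in at_infinity. exp (L l) = a l"
      "has_expansion at_infinity (\<lambda>l. 1 / of_real l) L (\<lambda>n. if n = 0 then 0 else \<i> * J (int n))"
    and L0: "\<forall>\<^sub>F l in at 0. exp (L0 l) = a l" "has_expansion (at 0) of_real L0 (\<lambda>n. \<i> * J (- int n))"
    and J0: "J 0 = of_real (- \<beta> / 2 * (Lim at_top u - Lim at_bot u))"
    using J unfolding time_integrals_alt by blast
  obtain b H H0 where b: "\<And>l. l \<noteq> 0 \<Longrightarrow> \<exists>M. is_time_monodromy m \<beta> Qm Qp u p l M \<and> b l = M $ 1 $ 1"
    and H: "\<forall>\<^sub>F l in at_infinity. exp (H l) = b l"
      "has_expansion at_infinity (\<lambda>l. 1 / of_real l) H (\<lambda>n. if n = 0 then 0 else \<i> * K (int n))"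
    and H0: "\<forall>\<^sub>F l in at 0. exp (H0 l) = b l" "has_expansion (at 0) of_real H0 (\<lambda>n. \<i> * K (- int n))"
    and K0: "K 0 = of_real (- \<beta> / 2 * (Lim at_top u - Lim at_bot u))"
    using K unfolding time_integrals_alt by blast
  have ab: "a l = b l" if l: "l \<noteq> 0" for l
  proof -
    obtain M M' where "is_time_monodromy m \<beta> Qm Qp u p l M" "a l = M $ 1 $ 1"
      "is_time_monodromy m \<beta> Qm Qp u p l M'" "b l = M' $ 1 $ 1"
      using a[OF l] b[OF l] by blast
    then show ?thesis using is_time_monodromy_unique[of m \<beta> Qm Qp u p l M M'] by simp
  qed
  have "\<forall>\<^sub>F l in at_infinity. exp (L l) = exp (H l)"
    using L(1) H(1) eventually_nonzero(1) by eventually_elim (simp add: ab)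
  moreover have "(L \<longlongrightarrow> 0) at_infinity" "(H \<longlongrightarrow> 0) at_infinity"
    using has_expansion_tendsto[OF L(2)] has_expansion_tendsto[OF H(2)] by simp_all
  ultimately have "\<forall>\<^sub>F l in at_infinity. L l = H l"
    using eventually_eq_if_exp_eq by blast
  from has_expansion_unique[OF L(2) H(2) this inverse_of_real_at_infinity(2)]
  have "(\<lambda>n. if n = 0 then 0 else \<i> * J (int n)) = (\<lambda>n. if n = 0 then 0 else \<i> * K (int n))"
    by (simp add: trivial_limit_at_infinity)
  from fun_cong[OF this] have pos: "n \<noteq> 0 \<Longrightarrow> J (int n) = K (int n)" for n
    by (metis mult_cancel_left complex_i_not_zero)
  have "\<forall>\<^sub>F l in at 0. exp (L0 l) = exp (H0 l)"
    using L0(1) H0(1) eventually_nonzero(2) by eventually_elim (simp add: ab)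
  moreover have "(L0 \<longlongrightarrow> \<i> * J 0) (at 0)" "(H0 \<longlongrightarrow> \<i> * J 0) (at 0)"
    using has_expansion_tendsto[OF L0(2)] has_expansion_tendsto[OF H0(2)] J0 K0 by simp_all
  ultimately have "\<forall>\<^sub>F l in at 0. L0 l = H0 l"
    using eventually_eq_if_exp_eq by blast
  from has_expansion_unique[OF L0(2) H0(2) this of_real_at_0(2)]
  have "(\<lambda>n. \<i> * J (- int n)) = (\<lambda>n. \<i> * K (- int n))" by simp
  from fun_cong[OF this] have neg: "J (- int n) = K (- int n)" for n
    by (metis mult_cancel_left complex_i_not_zero)
  show ?thesis
  proof
    fix n :: int
    show "J n = K n"
      using pos[of "nat n"] neg[of "nat (- n)"] by (cases "n > 0") auto
  qed
qed

text \<open>At \<open>n = 0\<close> this is the difference of the two prescribed values of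
  \<open>J 0\<close>. The other values are the expansion coefficients of the logarithm of
  \<open>monodromy_factor\<close> at infinity and at 0; the factor \<open>- \<i>\<close> is the
  division by \<open>\<i>\<close> in the definition of the integrals.\<close>

definition integral_shift :: "real \<Rightarrow> int \<Rightarrow> int \<Rightarrow> int \<Rightarrow> int \<Rightarrow> int \<Rightarrow> complex" where
  "integral_shift \<sigma> Qm Qp Qtm Qtp n =
    (let wp = \<i> * of_real (\<sigma> * defect_sign Qp Qtp); wm = \<i> * of_real (\<sigma> * defect_sign Qm Qtm) in
     if n = 0 then of_real (pi * of_int (Qp - Qm - (Qtp - Qtm)))
     else if n > 0 then - \<i> * (ln_coeff wp (nat n) - ln_coeff wm (nat n))
     else - \<i> * (ln_coeff (1 / wp) (nat (- n)) - ln_coeff (1 / wm) (nat (- n))))"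

text \<open>The factor \<open>monodromy_factor\<close> is \<open>(1 + wp / l) / (1 + wm / l)\<close> near infinity and
  \<open>(wp / wm) (1 + l / wp) / (1 + l / wm)\<close> near 0, where \<open>wp / wm = \<plusminus> 1\<close>.\<close>

lemma time_integrals_defect:
  assumes b: "\<beta> \<noteq> 0" and s: "\<sigma> \<noteq> 0"
    and u: "field_boundary \<beta> Qm Qp u" and v: "field_boundary \<beta> Qtm Qtp v"
    and J: "time_integrals m \<beta> Qm Qp u (defect_p m \<beta> \<sigma> u v) J"
  shows "time_integrals m \<beta> Qtm Qtp v (defect_q m \<beta> \<sigma> u v)
    (\<lambda>n. J n + integral_shift \<sigma> Qm Qp Qtm Qtp n)"
proof -
  obtain a L L0 where
    a: "\<And>l. l \<noteq> 0 \<Longrightarrow> \<exists>M. is_time_monodromy m \<beta> Qm Qp u (defect_p m \<beta> \<sigma> u v) l M \<and> a l = M $ 1 $ 1"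
    and L: "\<forall>\<^sub>F l in at_infinity. exp (L l) = a l"
      "has_expansion at_infinity (\<lambda>l. 1 / of_real l) L (\<lambda>n. if n = 0 then 0 else \<i> * J (int n))"
    and L0: "\<forall>\<^sub>F l in at 0. exp (L0 l) = a l" "has_expansion (at 0) of_real L0 (\<lambda>n. \<i> * J (- int n))"
    and J0: "J 0 = of_real (- \<beta> / 2 * (Lim at_top u - Lim at_bot u))"
    using J unfolding time_integrals_alt by blast
  define E where "E = integral_shift \<sigma> Qm Qp Qtm Qtp"
  define wp wm where "wp = \<i> * complex_of_real (\<sigma> * defect_sign Qp Qtp)"
    and "wm = \<i> * complex_of_real (\<sigma> * defect_sign Qm Qtm)"
  have w: "wp \<noteq> 0" "wm \<noteq> 0" using s by (simp_all add: wp_def wm_def defect_sign_def)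
  have E: "E n = (if n = 0 then of_real (pi * of_int (Qp - Qm - (Qtp - Qtm)))
     else if n > 0 then - \<i> * (ln_coeff wp (nat n) - ln_coeff wm (nat n))
     else - \<i> * (ln_coeff (1 / wp) (nat (- n)) - ln_coeff (1 / wm) (nat (- n))))" for n
    by (simp add: E_def integral_shift_def Let_def wp_def wm_def)
  have f: "monodromy_factor \<sigma> Qm Qp Qtm Qtp l = (of_real l + wp) / (of_real l + wm)" for l
    by (simp add: monodromy_factor_def Complex_eq wp_def wm_def)
  define a' where "a' l = monodromy_factor \<sigma> Qm Qp Qtm Qtp l * a l" for l
  define Lt where "Lt l = L l + (Ln (1 + wp * (1 / of_real l)) - Ln (1 + wm * (1 / of_real l)))" for l
  define Lt0 where "Lt0 l = L0 l + (\<i> * E 0 + (Ln (1 + 1 / wp * of_real l) - Ln (1 + 1 / wm * of_real l)))" for l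
  have nz: "of_real l + wp \<noteq> 0" "of_real l + wm \<noteq> 0" if "l \<noteq> 0" for l
    using that by (auto simp: wp_def wm_def complex_eq_iff)
  \<comment> \<open>The prescribed \<open>J 0\<close> on the two sides are compatible with the
    factor: its value at 0 is the ratio of the two signs, which is the parity of the change of
    charges.\<close>
  have expE: "exp (\<i> * E 0) = wp / wm"
  proof -
    have "exp (\<i> * E 0) = cis (pi * of_int (Qp - Qm - (Qtp - Qtm)))"
      by (simp add: E cis_conv_exp)
    also have "\<dots> = wp / wm"
      unfolding cis_pi_of_int using s by (auto simp: wp_def wm_def defect_sign_def)
    finally show ?thesis .
  qed
  have a': "\<exists>M. is_time_monodromy m \<beta> Qtm Qtp v (defect_q m \<beta> \<sigma> u v) l M \<and> a' l = M $ 1 $ 1"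
    if l: "l \<noteq> 0" for l
    using a[OF l] is_time_monodromy_defect[OF b s l u v] unfolding a'_def by metis
  have Lt: "\<forall>\<^sub>F l in at_infinity. exp (Lt l) = a' l"
    using L(1) eventually_nonzero(1)
  proof eventually_elim
    case (elim l)
    have "1 + wp * (1 / of_real l) = (of_real l + wp) / of_real l"
      "1 + wm * (1 / of_real l) = (of_real l + wm) / of_real l"
      using elim by (simp_all add: field_simps)
    then show ?case
      unfolding Lt_def a'_def f exp_add exp_diff using elim nz[of l] by (simp add: exp_Ln)
  qed
  have Lt0: "\<forall>\<^sub>F l in at 0. exp (Lt0 l) = a' l"
    using L0(1) eventually_nonzero(2)
  proof eventually_elim
    case (elim l)
    have "1 + 1 / wp * of_real l = (of_real l + wp) / wp" "1 + 1 / wm * of_real l = (of_real l + wm) / wm"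
      using w by (simp_all add: field_simps)
    then show ?case
      unfolding Lt0_def a'_def f exp_add exp_diff expE using elim nz[of l] w by (simp add: exp_Ln)
  qed
  have "has_expansion at_infinity (\<lambda>l. 1 / of_real l) Lt
      (\<lambda>n. (if n = 0 then 0 else \<i> * J (int n)) + (ln_coeff wp n - ln_coeff wm n))"
    unfolding Lt_def by (intro has_expansion_add has_expansion_diff has_expansion_Ln L w
        inverse_of_real_at_infinity)
  \<comment> \<open>At \<open>n = 0\<close> both values of \<open>ln_coeff\<close> are 0, so the
    expansion at infinity still starts with order 1.\<close>
  moreover have "(\<lambda>n. (if n = 0 then 0 else \<i> * J (int n)) + (ln_coeff wp n - ln_coeff wm n))
      = (\<lambda>n. if n = 0 then 0 else \<i> * (J (int n) + E (int n)))"
    by (auto simp: E ln_coeff_def algebra_simps)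
  ultimately have Xt: "has_expansion at_infinity (\<lambda>l. 1 / of_real l) Lt
      (\<lambda>n. if n = 0 then 0 else \<i> * (J (int n) + E (int n)))" by simp
  have "has_expansion (at 0) of_real Lt0
      (\<lambda>n. \<i> * J (- int n) + ((if n = 0 then \<i> * E 0 else 0) + (ln_coeff (1 / wp) n - ln_coeff (1 / wm) n)))"
    unfolding Lt0_def using w by (intro has_expansion_add has_expansion_const has_expansion_diff
        has_expansion_Ln L0 of_real_at_0) auto
  moreover have "(\<lambda>n. \<i> * J (- int n) + ((if n = 0 then \<i> * E 0 else 0) +
      (ln_coeff (1 / wp) n - ln_coeff (1 / wm) n))) = (\<lambda>n. \<i> * (J (- int n) + E (- int n)))"
  proof
    fix n :: nat
    show "\<i> * J (- int n) + ((if n = 0 then \<i> * E 0 else 0) +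
      (ln_coeff (1 / wp) n - ln_coeff (1 / wm) n)) = \<i> * (J (- int n) + E (- int n))"
      by (cases "n = 0") (simp_all add: E[of "- int n"] ln_coeff_def algebra_simps)
  qed
  ultimately have Xt0: "has_expansion (at 0) of_real Lt0 (\<lambda>n. \<i> * (J (- int n) + E (- int n)))" by simp
  have Lims: "Lim at_top u = 2 * pi * of_int Qp / \<beta>" "Lim at_bot u = 2 * pi * of_int Qm / \<beta>"
    "Lim at_top v = 2 * pi * of_int Qtp / \<beta>" "Lim at_bot v = 2 * pi * of_int Qtm / \<beta>"
    using field_boundary_tendsto[OF u] field_boundary_tendsto[OF v] by (auto intro: tendsto_Lim)
  have "J 0 + E 0 = of_real (- \<beta> / 2 * (Lim at_top v - Lim at_bot v))"
    unfolding J0 E Lims using b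
    by (simp only: if_True refl of_real_add[symmetric] of_real_eq_iff) (simp add: field_simps)
  then show ?thesis
    unfolding time_integrals_alt E_def[symmetric] using a' Lt Xt Lt0 Xt0 by blast
qed

lemma defect_momenta_swap:
  "defect_p m \<beta> (- \<sigma>) v u = defect_q m \<beta> \<sigma> u v" "defect_q m \<beta> (- \<sigma>) v u = defect_p m \<beta> \<sigma> u v"
proof -
  have "half_sum \<beta> v u t = half_sum \<beta> u v t" "half_diff \<beta> v u t = - half_diff \<beta> u v t" for t
    by (simp_all add: half_sum_def half_diff_def field_simps)
  then show "defect_p m \<beta> (- \<sigma>) v u = defect_q m \<beta> \<sigma> u v" "defect_q m \<beta> (- \<sigma>) v u = defect_p m \<beta> \<sigma> u v"
    by (auto simp: defect_p_def defect_q_def algebra_simps)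
qed

text \<open>If the integrals exist on the tilded side, \<open>defect_momenta_swap\<close> presents
  the inverse transformation as a defect with parameter \<open>- \<sigma>\<close>, which gives
  existence on the other side. Uniqueness then fixes the shift.\<close>

lemma integrals_shifted_defect:
  assumes b: "\<beta> \<noteq> 0" and s: "\<sigma> \<noteq> 0"
    and u: "field_boundary \<beta> Qm Qp u" and v: "field_boundary \<beta> Qtm Qtp v"
  shows "integrals_shifted_by m \<beta> Qm Qp Qtm Qtp (integral_shift \<sigma> Qm Qp Qtm Qtp)
    (u, defect_p m \<beta> \<sigma> u v) (v, defect_q m \<beta> \<sigma> u v)"
proof -
  have "- \<sigma> \<noteq> 0" using s by simp
  from time_integrals_defect[OF b this v u]
  have "time_integrals m \<beta> Qtm Qtp v (defect_q m \<beta> \<sigma> u v) J \<Longrightarrow>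
      \<exists>J'. time_integrals m \<beta> Qm Qp u (defect_p m \<beta> \<sigma> u v) J'" for J
    unfolding defect_momenta_swap by blast
  then show ?thesis
    using time_integrals_defect[OF b s u v] time_integrals_unique
    unfolding integrals_shifted_by_def by fastforce
qed

theorem proposition3p1:
  fixes m \<beta> \<sigma> :: real and Qm Qp Qtm Qtp :: int
  assumes "m \<noteq> 0" and "\<beta> \<noteq> 0" and "\<sigma> \<noteq> 0"
  shows
    "canonical_transformation m \<beta> Qm Qp Qtm Qtp (defect_transformation m \<beta> \<sigma>) \<and>
     generating_functional \<beta> Qm Qp Qtm Qtp (defect_transformation m \<beta> \<sigma>)
       (S_T m \<beta> \<sigma> Qm Qp Qtm Qtp) \<and>
     (\<forall>u v. field_boundary \<beta> Qm Qp u \<longrightarrow> field_boundary \<beta> Qtm Qtp v \<longrightarrow>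
        integrable lborel (\<lambda>t. L_defect m \<beta> \<sigma> u v t - L_vacuum m \<beta> \<sigma> Qm Qp Qtm Qtp t)) \<and>
     (\<forall>\<phi> \<phi>t. defect_fields m \<beta> Qm Qp Qtm Qtp \<phi> \<phi>t \<longrightarrow>
        (defect_conditions m \<beta> \<sigma> (\<phi> 0) (dx {0..} \<phi> 0) (\<phi>t 0) (dx {..0} \<phi>t 0) \<longleftrightarrow>
           has_functional_derivative (\<lambda>u. S_T m \<beta> \<sigma> Qm Qp Qtm Qtp u (\<phi>t 0))
             (\<phi> 0) (momentum {0..} \<phi> 0) \<and>
           has_functional_derivative (\<lambda>v. S_T m \<beta> \<sigma> Qm Qp Qtm Qtp (\<phi> 0) v)
             (\<phi>t 0) (\<lambda>t. - momentum {..0} \<phi>t 0 t))) \<and>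
     (\<exists>E. \<forall>\<phi> \<phi>t. defect_fields m \<beta> Qm Qp Qtm Qtp \<phi> \<phi>t \<longrightarrow>
        defect_conditions m \<beta> \<sigma> (\<phi> 0) (dx {0..} \<phi> 0) (\<phi>t 0) (dx {..0} \<phi>t 0) \<longrightarrow>
        integrals_shifted_by m \<beta> Qm Qp Qtm Qtp E
          (\<phi> 0, momentum {0..} \<phi> 0) (\<phi>t 0, momentum {..0} \<phi>t 0))"
proof -
  let ?R = "defect_transformation m \<beta> \<sigma>" and ?E = "integral_shift \<sigma> Qm Qp Qtm Qtp"
  note b = \<open>\<beta> \<noteq> 0\<close>
  note gen = generating_functional_S_T[OF b, of Qm Qp Qtm Qtp m \<sigma>]
  \<comment> \<open>The constants \<open>?E\<close> involve \<sigma> and the four charges only, so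
    they can be chosen before the fields.\<close>
  have shift: "integrals_shifted_by m \<beta> Qm Qp Qtm Qtp ?E (u, p) (v, q)"
    if "(u, p) \<in> phase_space \<beta> Qm Qp" "(v, q) \<in> phase_space \<beta> Qtm Qtp"
      "defect_conditions m \<beta> \<sigma> u (\<lambda>t. - p t) v (\<lambda>t. - q t)" for u p v q
    using that integrals_shifted_defect[OF b \<open>\<sigma> \<noteq> 0\<close>]
    by (auto simp: phase_space_def defect_conditions_iff)
  \<comment> \<open>Rewriting the spatial derivative as minus the momentum turns the conditions on
    the fields into the relation between phase space points treated above.\<close>
  have dx: "dx X \<phi> x = (\<lambda>t. - momentum X \<phi> x t)" for X \<phi> x
    by (simp add: momentum_def)
  have "canonical_transformation m \<beta> Qm Qp Qtm Qtp ?R"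
    unfolding canonical_transformation_def
  proof (intro conjI)
    show "\<forall>u v. field_boundary \<beta> Qm Qp u \<longrightarrow> field_boundary \<beta> Qtm Qtp v \<longrightarrow>
        (\<exists>!(p, q). schwartz p \<and> schwartz q \<and> ?R (u, p) (v, q))"
      using defect_momenta_ex1[OF b] by blast
    show "\<exists>S. generating_functional \<beta> Qm Qp Qtm Qtp ?R S" using gen by blast
    show "\<exists>E. \<forall>w\<in>phase_space \<beta> Qm Qp. \<forall>wt\<in>phase_space \<beta> Qtm Qtp. ?R w wt \<longrightarrow>
        integrals_shifted_by m \<beta> Qm Qp Qtm Qtp E w wt"
      using shift by (intro exI[of _ ?E]) (auto simp: defect_transformation_def)
  qed
  moreover note gen
  moreover have "\<forall>u v. field_boundary \<beta> Qm Qp u \<longrightarrow> field_boundary \<beta> Qtm Qtp v \<longrightarrow>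
      integrable lborel (\<lambda>t. L_defect m \<beta> \<sigma> u v t - L_vacuum m \<beta> \<sigma> Qm Qp Qtm Qtp t)"
    using integrable_L_defect[OF b] by blast
  moreover have "\<forall>\<phi> \<phi>t. defect_fields m \<beta> Qm Qp Qtm Qtp \<phi> \<phi>t \<longrightarrow>
      (defect_conditions m \<beta> \<sigma> (\<phi> 0) (dx {0..} \<phi> 0) (\<phi>t 0) (dx {..0} \<phi>t 0) \<longleftrightarrow>
         has_functional_derivative (\<lambda>u. S_T m \<beta> \<sigma> Qm Qp Qtm Qtp u (\<phi>t 0))
           (\<phi> 0) (momentum {0..} \<phi> 0) \<and>
         has_functional_derivative (\<lambda>v. S_T m \<beta> \<sigma> Qm Qp Qtm Qtp (\<phi> 0) v)
           (\<phi>t 0) (\<lambda>t. - momentum {..0} \<phi>t 0 t))"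
    unfolding dx defect_fields_def phase_space_def
    using defect_conditions_iff_functional_derivatives[OF b] by auto
  moreover have "\<exists>E. \<forall>\<phi> \<phi>t. defect_fields m \<beta> Qm Qp Qtm Qtp \<phi> \<phi>t \<longrightarrow>
      defect_conditions m \<beta> \<sigma> (\<phi> 0) (dx {0..} \<phi> 0) (\<phi>t 0) (dx {..0} \<phi>t 0) \<longrightarrow>
      integrals_shifted_by m \<beta> Qm Qp Qtm Qtp E
        (\<phi> 0, momentum {0..} \<phi> 0) (\<phi>t 0, momentum {..0} \<phi>t 0)"
    unfolding dx defect_fields_def using shift by (intro exI[of _ ?E]) blast
  ultimately show ?thesis by blast
qed

end
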